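(* Let $X$ be a pure $d$-dimensional proper cubical complex which is a near-prism in direction $1$, and let $\ell$ denote the number of facets of $\mathrm{link}_1X$. If $X$ is also a prism (in direction $1$), then $$\mathbf{s}(X)=2^\ell+\mathbf{s}(\mathrm{link}_1X).$$ Otherwise, $$\mathbf{s}(X)=\mathbf{s}(\mathrm{del}_1X)\cup\bigl(2^\ell+(\mathbf{s}(\mathrm{del}_1X)\cup\mathbf{s}(\mathrm{link}_1X))\bigr).$$
   Context: For a finite set $D$ of positive integers, a proper cubical complex with direction set $D$ is a nonempty family $X$ of tuples $f=(f_i)_{i\in D}$ with $f_i\in\{0,1,\circledast\}$, closed under replacing entries $\circledast$ by $0$ or $1$; such a replacement gives the faces of $f$, and the boundary of $f$ is the set of its proper faces. $\mathrm{dir}(f)=\{i\in D : f_i=\circledast\}$ and $\dim f=|\mathrm{dir}(f)|$; $X_i$ is the set of $i$-dimensional faces. A facet is a face maximal under inclusion of faces; $X$ is pure if all facets have the same dimension. Here $X$ has direction set $[n]=\{1,\dots,n\}$. Laplacians: for a face $f$ of $g$ with $\dim f=i-1$, $\dim g=i$, write $\mathrm{dir}(g)=\{a_1<\dots<a_i\}$, $\mathrm{dir}(f)=\mathrm{dir}(g)\setminus\{a_j\}$, and put $\varepsilon(f,g)=(-1)^j$ if $f_{a_j}=0$, $(-1)^{j+1}$ if $f_{a_j}=1$; if $f$ is not a face of $g$ put $\varepsilon(f,g)=0$. $\partial_{X,i}\colon C_i(X)\to C_{i-1}(X)$, $[g]\mapsto\sum_{f\in X_{i-1}}\varepsilon(f,g)[f]$,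 where $C_i(X)$ is the free module on $X_i$; $\partial^*_{X,i}$ is its transpose, and $L^{\rm ud}_{X,i}=\partial_{X,i+1}\partial^*_{X,i+1}$. For a complex $Y$, $\mathbf{s}(Y)$ is the weakly decreasing sequence of nonzero eigenvalues (with multiplicity) of $L^{\rm ud}_{Y,\dim Y-1}$ (it is the empty sequence when $\dim Y\le 0$, there being no $(-1)$-dimensional faces). For $i\in[n]$ let $f\backslash f_i$ denote the tuple $f$ with its $i$-th entry removed. Define $$\mathrm{del}_iX=\{f\backslash f_i : f\in X,\ f_i\neq\circledast\},\qquad \mathrm{link}_iX=\{f\backslash f_i : f\in X,\ f_i=\circledast\},$$ cubical complexes with direction set $[n]\setminus\{i\}$. For a complex $Y$ with direction set $[n]\setminus\{i\}$, the prism of $Y$ in direction $i$ is $\mathbf{P}_iY=\{f\in\{0,1,\circledast\}^n : f\backslash f_i\in Y\}$, and $\mathbf{0}^iY$, $\mathbf{1}^iY$ are the subcomplexes of $\mathbf{P}_iY$ consisting of the faces with $f_i=0$, respectively $f_i=1$. "$X$ is a prism in direction $1$" means $X=\mathbf{P}_1Y$ for some such $Y$. $X$ is a near-prism in direction $i$ if (1) the boundary of every face of $\mathrm{del}_iX$ is contained in $\mathrm{link}_iX$, and (2) both $\mathbf{0}^i(\mathrm{del}_iX)$ and $\mathbf{1}^i(\mathrm{del}_iX)$ are contained in $X$. Sequences: weakly decreasing sequences of nonnegative numbers are considered up to trailing zeros; $\cup$ is multiset union (re-sorted in weakly decreasing order); $2^\ell$ is the sequence $(2,\dots,2)$ of length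 $\ell$; sums of sequences are entrywise, so $2^\ell+\mathbf{a}$ is obtained from $\mathbf{a}$ by adding $2$ to each of its first $\ell$ entries, padding $\mathbf{a}$ with $0$'s at the end if necessary. *)

theory Defs
  imports
    "Jordan_Normal_Form.Char_Poly"
    "HOL-Library.More_List"
    "HOL-Library.Multiset"
begin

section \<open>Proper cubical complexes\<close>

datatype entry = E0 | E1 | Star

text \<open>A tuple \<open>(f\<^sub>i)\<close> indexed by a set \<open>D\<close> of directions is a map with domain \<open>D\<close>.\<close>

type_synonym face = "nat \<Rightarrow> entry option"

definition face_of :: "face \<Rightarrow> face \<Rightarrow> bool" where
  "face_of f g \<longleftrightarrow> dom f = dom g \<and> (\<forall>i. g i \<noteq> Some Star \<longrightarrow> f i = g i)"

definition boundary :: "face \<Rightarrow> face set" where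
  "boundary f = {g. face_of g f \<and> g \<noteq> f}"

definition cubical_complex :: "nat set \<Rightarrow> face set \<Rightarrow> bool" where
  "cubical_complex D X \<longleftrightarrow>
     finite D \<and> (\<forall>i\<in>D. 0 < i) \<and> X \<noteq> {} \<and> (\<forall>f\<in>X. dom f = D) \<and>
     (\<forall>g\<in>X. \<forall>f. face_of f g \<longrightarrow> f \<in> X)"

definition dirs :: "face \<Rightarrow> nat set" where
  "dirs f = {i. f i = Some Star}"

definition face_dim :: "face \<Rightarrow> nat" where
  "face_dim f = card (dirs f)"

text \<open>Dimensions of complexes are integers, so that the index \<open>dim Y - 1\<close> below needs no
  truncated subtraction; the empty family, which may arise as a link, has dimension \<open>-1\<close>.\<close>

definition faces :: "face set \<Rightarrow> int \<Rightarrow> face set" where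
  "faces X i = {f \<in> X. int (face_dim f) = i}"

definition complex_dim :: "face set \<Rightarrow> int" where
  "complex_dim X = (if X = {} then -1 else int (Max (face_dim ` X)))"

definition facets :: "face set \<Rightarrow> face set" where
  "facets X = {f \<in> X. \<forall>g\<in>X. face_of f g \<longrightarrow> g = f}"

definition pure :: "face set \<Rightarrow> bool" where
  "pure X \<longleftrightarrow> (\<forall>f\<in>facets X. \<forall>g\<in>facets X. face_dim f = face_dim g)"

section \<open>Deletion, link, prisms and near-prisms\<close>

definition remove_entry :: "nat \<Rightarrow> face \<Rightarrow> face" where
  "remove_entry i f = f |` (- {i})"

definition del :: "nat \<Rightarrow> face set \<Rightarrow> face set" where
  "del i X = {remove_entry i f | f. f \<in> X \<and> f i \<noteq> Some Star}"

definition link :: "nat \<Rightarrow> face set \<Rightarrow> face set" where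
  "link i X = {remove_entry i f | f. f \<in> X \<and> f i = Some Star}"

text \<open>If the faces in \<open>Y\<close> have domain \<open>D - {i}\<close> with \<open>i \<in> D\<close>, then the faces in
  \<open>prism i Y\<close> have domain \<open>D\<close>.\<close>

definition prism :: "nat \<Rightarrow> face set \<Rightarrow> face set" where
  "prism i Y = {f. i \<in> dom f \<and> remove_entry i f \<in> Y}"

definition zero_copy :: "nat \<Rightarrow> face set \<Rightarrow> face set" where
  "zero_copy i Y = {f \<in> prism i Y. f i = Some E0}"

definition one_copy :: "nat \<Rightarrow> face set \<Rightarrow> face set" where
  "one_copy i Y = {f \<in> prism i Y. f i = Some E1}"

definition is_prism :: "nat set \<Rightarrow> nat \<Rightarrow> face set \<Rightarrow> bool" where
  "is_prism D i X \<longleftrightarrow> (\<exists>Y. cubical_complex (D - {i}) Y \<and> X = prism i Y)"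

definition near_prism :: "nat \<Rightarrow> face set \<Rightarrow> bool" where
  "near_prism i X \<longleftrightarrow>
     (\<forall>f\<in>del i X. boundary f \<subseteq> link i X) \<and>
     zero_copy i (del i X) \<subseteq> X \<and> one_copy i (del i X) \<subseteq> X"

section \<open>Laplacians\<close>

text \<open>For \<open>dirs g = {a\<^sub>1 < a\<^sub>2 < \<dots>}\<close> and \<open>a = a\<^sub>j\<close>, the position \<open>j\<close> is the number of
  elements of \<open>dirs g\<close> that are at most \<open>a\<close>.\<close>

definition incidence :: "face \<Rightarrow> face \<Rightarrow> real" where
  "incidence f g =
     (if face_of f g \<and> face_dim g = face_dim f + 1 then
        let a = the_elem (dirs g - dirs f); j = card {b \<in> dirs g. b \<le> a}
        in if f a = Some E0 then (-1) ^ j else (-1) ^ (j + 1)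
      else 0)"

text \<open>The spaces \<open>C\<^sub>i(X)\<close> are taken over the reals. Boundary maps are written as matrices with
  respect to an arbitrary but fixed enumeration of the faces of each dimension; the spectrum of the
  Laplacian does not depend on it.\<close>

definition face_list :: "face set \<Rightarrow> int \<Rightarrow> face list" where
  "face_list X i = (SOME fs. distinct fs \<and> set fs = faces X i)"

definition boundary_mat :: "face set \<Rightarrow> int \<Rightarrow> real mat" where
  "boundary_mat X i =
     mat (length (face_list X (i - 1))) (length (face_list X i))
       (\<lambda>(r, c). incidence (face_list X (i - 1) ! r) (face_list X i ! c))"

definition laplacian_ud :: "face set \<Rightarrow> int \<Rightarrow> real mat" where
  "laplacian_ud X i = boundary_mat X (i + 1) * transpose_mat (boundary_mat X (i + 1))"

section \<open>Sequences and spectra\<close>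

text \<open>Weakly decreasing sequences are lists, compared up to trailing zeros.\<close>

definition seq_eq :: "real list \<Rightarrow> real list \<Rightarrow> bool" (infix \<open>\<doteq>\<close> 50) where
  "a \<doteq> b \<longleftrightarrow> strip_while (HOL.eq 0) a = strip_while (HOL.eq 0) b"

definition seq_union :: "real list \<Rightarrow> real list \<Rightarrow> real list" (infixl \<open>\<uplus>\<close> 65) where
  "a \<uplus> b = rev (sort (a @ b))"

definition seq_add :: "real list \<Rightarrow> real list \<Rightarrow> real list" (infixl \<open>\<oplus>\<close> 65) where
  "a \<oplus> b = map (\<lambda>k. nth_default 0 a k + nth_default 0 b k) [0..<max (length a) (length b)]"

text \<open>The Laplacian is a real symmetric matrix, so all roots of its characteristic polynomial are
  real and their algebraic and geometric multiplicities agree. If \<open>complex_dim Y \<le> 0\<close>, it is the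
  matrix of size 0 and the spectrum is the empty list.\<close>

definition spectrum_seq :: "face set \<Rightarrow> real list" where
  "spectrum_seq Y =
     rev (sorted_list_of_multiset
       {#x \<in># proots (char_poly (laplacian_ud Y (complex_dim Y - 1))). x \<noteq> 0#})"

end

theory Submission
  imports Defs
begin

text \<open>
  Write \<open>Y\<close> for the deletion and \<open>Z\<close> for the link, let \<open>A\<close> be the boundary matrix from the
  \<open>d\<close>-faces of \<open>Y\<close> to its \<open>(d - 1)\<close>-faces and \<open>C\<close> the one from the \<open>(d - 1)\<close>-faces of \<open>Z\<close> to its
  \<open>(d - 2)\<close>-faces. Purity and the near-prism conditions force \<open>Y\<close> and \<open>Z\<close> to have the same faces
  below dimension \<open>d\<close>, and make the \<open>(d - 1)\<close>-faces of \<open>Z\<close> exactly its facets; hence the columns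
  of \<open>C\<close> are indexed like the rows of \<open>A\<close>, by \<open>l\<close> faces, and \<open>C A = 0\<close> because a boundary has no
  boundary.

  Two operators send chains on these \<open>l\<close> faces into the \<open>(d - 1)\<close>-chains of \<open>X\<close>: \<open>V\<close> takes \<open>z\<close> to
  the sum of its two copies, \<open>H\<close> takes \<open>z\<close> to the boundary of the cell \<open>z\<close> extended in the
  direction of the prism. That boundary meets the two copies of \<open>z\<close> with opposite signs, so the
  images of \<open>V\<close> and \<open>H\<close> are orthogonal. The \<open>d\<close>-faces of \<open>X\<close> are the two copies of each \<open>d\<close>-face
  \<open>y\<close> of \<open>Y\<close> and the extended cells; the boundaries of the two copies of \<open>y\<close> have sum \<open>V A y\<close> and
  difference \<open>H A y\<close>. With \<open>P = A A\<^sup>T\<close> and \<open>Q = C\<^sup>T C\<close> this gives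
  \<open>L = V (P/2) V\<^sup>T + H (P/2 + 1) H\<^sup>T\<close>, together with \<open>V\<^sup>T V = 2\<close>, \<open>V\<^sup>T H = 0\<close>, \<open>H\<^sup>T H = 2 + Q\<close> and
  \<open>P Q = 0\<close>.

  Two facts about characteristic polynomials then finish the computation
  (\<open>nonzero_roots_orthogonal_sandwich\<close>): \<open>F G\<close> and \<open>G F\<close> have the same nonzero roots
  (\<open>nonzero_roots_mult_commute\<close>), and if \<open>F G = 0\<close> then the nonzero roots of \<open>F + G\<close> are those of
  \<open>F\<close> together with those of \<open>G\<close> (\<open>nonzero_roots_add_orthogonal\<close>). The first summand of \<open>L\<close> has
  the nonzero spectrum of \<open>(P/2) V\<^sup>T V = P\<close>, the Laplacian of \<open>Y\<close>. The second one has that of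
  \<open>(P/2 + 1) (2 + Q) = 2 + (P + Q)\<close>: all \<open>l\<close> eigenvalues of \<open>P + Q\<close>, the zero ones included, are
  raised by \<open>2\<close>, and the nonzero ones among them come from \<open>P\<close> and from \<open>C C\<^sup>T\<close>, the Laplacian of
  \<open>Z\<close>. In a prism \<open>Y = Z\<close> has no \<open>d\<close>-faces, so \<open>P = 0\<close>.
\<close>

section \<open>Characteristic polynomials and nonzero eigenvalues\<close>

lemma char_poly_matrix_carrier:
  assumes "A \<in> carrier_mat n n"
  shows "char_poly_matrix A = [:0, 1:] \<cdot>\<^sub>m 1\<^sub>m n + - map_mat (\<lambda>a. [:a:]) A"
  using assms by (intro eq_matI) (auto simp: char_poly_matrix_def)

lemma map_mat_const_poly_mult:
  fixes A :: "'a :: comm_ring_1 mat"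
  assumes "A \<in> carrier_mat n m" and "B \<in> carrier_mat m k"
  shows "map_mat (\<lambda>a. [:a:]) (A * B) = map_mat (\<lambda>a. [:a:]) A * map_mat (\<lambda>a. [:a:]) B"
proof -
  interpret h: semiring_hom "\<lambda>a::'a. [:a:]" by unfold_locales auto
  show ?thesis using assms by (rule h.mat_hom_mult)
qed

text \<open>
  Both sides are \<open>[:0, 1:] ^ m\<close> times the determinant of the block matrix with rows \<open>(x, A)\<close> and
  \<open>(B, 1)\<close>: clearing the block \<open>B\<close> by column operations leaves the characteristic matrix of \<open>A B\<close>,
  clearing it by row operations, after scaling by \<open>x\<close>, leaves that of \<open>B A\<close>.
\<close>

lemma char_poly_mult_commute:
  fixes A :: "'a :: idom mat"
  assumes A: "A \<in> carrier_mat n m" and B: "B \<in> carrier_mat m n"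
  shows "[:0, 1:] ^ m * char_poly (A * B) = [:0, 1:] ^ n * char_poly (B * A)"
proof -
  define x where "x = ([:0, 1:] :: 'a poly)"
  define F where "F = map_mat (\<lambda>a. [:a:]) A"
  define G where "G = map_mat (\<lambda>a. [:a:]) B"
  note c = char_poly_matrix_carrier[folded x_def]
  have F[simp]: "F \<in> carrier_mat n m" and G[simp]: "G \<in> carrier_mat m n"
    using A B by (auto simp: F_def G_def)
  have FG: "char_poly_matrix (A * B) = x \<cdot>\<^sub>m 1\<^sub>m n + - (F * G)"
    "char_poly_matrix (B * A) = x \<cdot>\<^sub>m 1\<^sub>m m + - (G * F)"
    using A B by (simp_all add: c[of _ n] c[of _ m] F_def G_def map_mat_const_poly_mult[of _ _ _ _ n]
        map_mat_const_poly_mult[of _ _ _ _ m] x_def)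
  let ?M = "four_block_mat (x \<cdot>\<^sub>m 1\<^sub>m n) F G (1\<^sub>m m)"
  let ?R = "four_block_mat (1\<^sub>m n) (0\<^sub>m n m) (- G) (1\<^sub>m m)"
  let ?L = "four_block_mat (1\<^sub>m n) (0\<^sub>m n m) (- G) (x \<cdot>\<^sub>m 1\<^sub>m m)"
  have [simp]: "?M \<in> carrier_mat (n + m) (n + m)" "?R \<in> carrier_mat (n + m) (n + m)"
    "?L \<in> carrier_mat (n + m) (n + m)" by auto
  have "?M * ?R = four_block_mat (x \<cdot>\<^sub>m 1\<^sub>m n * 1\<^sub>m n + F * - G) (x \<cdot>\<^sub>m 1\<^sub>m n * 0\<^sub>m n m + F * 1\<^sub>m m)
      (G * 1\<^sub>m n + 1\<^sub>m m * - G) (G * 0\<^sub>m n m + 1\<^sub>m m * 1\<^sub>m m)"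
    by (rule mult_four_block_mat) auto
  also have "x \<cdot>\<^sub>m 1\<^sub>m n * 1\<^sub>m n + F * - G = char_poly_matrix (A * B)"
    unfolding FG uminus_mult_right_mat[of F G, unfolded carrier_matD[OF F] carrier_matD[OF G], OF refl] by simp
  also have "x \<cdot>\<^sub>m 1\<^sub>m n * 0\<^sub>m n m + F * 1\<^sub>m m = F"
    by (simp add: right_mult_one_mat[OF F])
  also have "G * 1\<^sub>m n + 1\<^sub>m m * - G = 0\<^sub>m m n"
    by (simp add: right_mult_one_mat[OF G] left_mult_one_mat[of "- G" m n] add_uminus_minus_mat[OF G G] minus_r_inv_mat[OF G])
  also have "G * 0\<^sub>m n m + 1\<^sub>m m * 1\<^sub>m m = 1\<^sub>m m"
    by (simp add: right_mult_zero_mat[OF G])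
  finally have "det (?M * ?R) = det (four_block_mat (char_poly_matrix (A * B)) F (0\<^sub>m m n) (1\<^sub>m m))"
    by simp
  also have "\<dots> = char_poly (A * B)"
    using A B by (subst det_four_block_mat_lower_left_zero[of _ n _ m]) (auto simp: char_poly_def)
  also have "det (?M * ?R) = det ?M * det ?R"
    by (rule det_mult) auto
  also have "det ?R = 1"
    by (subst det_four_block_mat_upper_right_zero[of _ n _ m]) auto
  finally have 1: "det ?M = char_poly (A * B)" by simp
  have "?L * ?M = four_block_mat (1\<^sub>m n * (x \<cdot>\<^sub>m 1\<^sub>m n) + 0\<^sub>m n m * G) (1\<^sub>m n * F + 0\<^sub>m n m * 1\<^sub>m m)
      (- G * (x \<cdot>\<^sub>m 1\<^sub>m n) + x \<cdot>\<^sub>m 1\<^sub>m m * G) (- G * F + x \<cdot>\<^sub>m 1\<^sub>m m * 1\<^sub>m m)"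
    by (rule mult_four_block_mat) auto
  also have "1\<^sub>m n * (x \<cdot>\<^sub>m 1\<^sub>m n) + 0\<^sub>m n m * G = x \<cdot>\<^sub>m 1\<^sub>m n"
    by (simp add: left_mult_zero_mat[OF G])
  also have "1\<^sub>m n * F + 0\<^sub>m n m * 1\<^sub>m m = F"
    by (simp add: left_mult_one_mat[OF F])
  also have "- G * (x \<cdot>\<^sub>m 1\<^sub>m n) + x \<cdot>\<^sub>m 1\<^sub>m m * G = 0\<^sub>m m n"
    by (simp add: mult_smult_distrib[of _ m n _ n] mult_smult_assoc_mat[of _ m m _ n]
        right_mult_one_mat[of "- G" m n] left_mult_one_mat[OF G])
      (intro eq_matI, auto simp: carrier_matD[OF G])
  also have "- G * F + x \<cdot>\<^sub>m 1\<^sub>m m * 1\<^sub>m m = char_poly_matrix (B * A)"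
    unfolding FG uminus_mult_left_mat[of G F, unfolded carrier_matD[OF F] carrier_matD[OF G], OF refl]
    using comm_add_mat[of "- (G * F)" m m "x \<cdot>\<^sub>m 1\<^sub>m m"] mult_carrier_mat[OF G F] by simp
  finally have "det (?L * ?M) = det (four_block_mat (x \<cdot>\<^sub>m 1\<^sub>m n) F (0\<^sub>m m n) (char_poly_matrix (B * A)))"
    by simp
  also have "\<dots> = x ^ n * char_poly (B * A)"
    using A B by (subst det_four_block_mat_lower_left_zero[of _ n _ m]) (auto simp: char_poly_def)
  also have "det (?L * ?M) = det ?L * det ?M"
    by (rule det_mult) auto
  also have "det ?L = x ^ m"
    by (subst det_four_block_mat_upper_right_zero[of _ n _ m]) auto
  finally show ?thesis using 1 by (simp add: x_def)
qed

text \<open>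
  Since \<open>A B = 0\<close>, \<open>(x - A) (x - B) = x (x - (A + B))\<close>; take determinants.
\<close>

lemma char_poly_add_orthogonal:
  fixes A :: "'a :: idom mat"
  assumes A: "A \<in> carrier_mat n n" and B: "B \<in> carrier_mat n n" and AB: "A * B = 0\<^sub>m n n"
  shows "[:0, 1:] ^ n * char_poly (A + B) = char_poly A * char_poly B"
proof -
  let ?x = "[:0, 1:] :: 'a poly"
  let ?A = "map_mat (\<lambda>a. [:a:]) A" and ?B = "map_mat (\<lambda>a. [:a:]) B"
  have cA: "?A \<in> carrier_mat n n" and cB: "?B \<in> carrier_mat n n" using A B by auto
  have 0: "?A * ?B = 0\<^sub>m n n"
    unfolding map_mat_const_poly_mult[OF A B, symmetric] AB by (intro eq_matI) auto
  have "char_poly_matrix A * char_poly_matrix B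
      = (?x \<cdot>\<^sub>m 1\<^sub>m n + - ?A) * (?x \<cdot>\<^sub>m 1\<^sub>m n) + (?x \<cdot>\<^sub>m 1\<^sub>m n + - ?A) * - ?B"
    unfolding char_poly_matrix_carrier[OF A] char_poly_matrix_carrier[OF B]
    by (rule mult_add_distrib_mat[of _ n n]) (use A B in auto)
  also have "\<dots> = (?x * ?x) \<cdot>\<^sub>m 1\<^sub>m n + - (?x \<cdot>\<^sub>m ?A) + (- (?x \<cdot>\<^sub>m ?B) + ?A * ?B)"
    using cA cB
    by (subst (1 2) add_mult_distrib_mat[of _ n n])
      (auto simp: mult_smult_distrib[of _ n n _ n] mult_smult_assoc_mat[of _ n n _ n]
        uminus_mult_right_mat uminus_mult_left_mat intro!: eq_matI)
  also have "\<dots> = ?x \<cdot>\<^sub>m char_poly_matrix (A + B)"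
    using A B unfolding 0 by (intro eq_matI) (auto simp: char_poly_matrix_def algebra_simps)
  finally have "det (char_poly_matrix A * char_poly_matrix B) = ?x ^ n * char_poly (A + B)"
    using A B by (simp add: char_poly_def char_poly_matrix_def)
  then show ?thesis using A B by (simp add: char_poly_def det_mult[of _ n])
qed

lemma poly_char_poly_shift:
  fixes S :: "'a :: field mat"
  assumes S: "S \<in> carrier_mat n n"
  shows "poly (char_poly (c \<cdot>\<^sub>m 1\<^sub>m n + S)) x = poly (char_poly S) (x - c)"
proof -
  have "char_matrix (c \<cdot>\<^sub>m 1\<^sub>m n + S) x = char_matrix S (x - c)"
    using S by (intro eq_matI) (auto simp: char_matrix_def)
  then show ?thesis using S by (simp add: char_poly_matrix[of _ n])
qed

definition nonzero_roots :: "'a :: idom poly \<Rightarrow> 'a multiset" where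
  "nonzero_roots p = {#x \<in># proots p. x \<noteq> 0#}"

lemma char_poly_nonzero:
  fixes A :: "'a :: idom mat"
  assumes "A \<in> carrier_mat n n" shows "char_poly A \<noteq> 0"
  using degree_monic_char_poly[OF assms] by auto

lemma nonzero_roots_mult:
  "p \<noteq> 0 \<Longrightarrow> q \<noteq> 0 \<Longrightarrow> nonzero_roots (p * q) = nonzero_roots p + nonzero_roots q"
  by (simp add: nonzero_roots_def proots_mult)

lemma nonzero_roots_power_x: "nonzero_roots ([:0, 1:] ^ k :: 'a :: idom poly) = {#}"
  by (induction k) (simp_all add: nonzero_roots_def proots_mult)

lemma nonzero_roots_shift_power:
  "p \<noteq> 0 \<Longrightarrow> nonzero_roots ([:0, 1:] ^ k * p) = nonzero_roots p"
  by (simp add: nonzero_roots_mult nonzero_roots_power_x)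

lemma nonzero_roots_mult_commute:
  fixes A :: "'a :: idom mat"
  assumes A: "A \<in> carrier_mat n m" and B: "B \<in> carrier_mat m n"
  shows "nonzero_roots (char_poly (A * B)) = nonzero_roots (char_poly (B * A))"
  using arg_cong[OF char_poly_mult_commute[OF A B], of nonzero_roots] A B
    char_poly_nonzero[of "A * B" n] char_poly_nonzero[of "B * A" m]
  by (auto simp: nonzero_roots_shift_power)

lemma nonzero_roots_add_orthogonal:
  fixes A :: "'a :: idom mat"
  assumes A: "A \<in> carrier_mat n n" and B: "B \<in> carrier_mat n n" and AB: "A * B = 0\<^sub>m n n"
  shows "nonzero_roots (char_poly (A + B))
    = nonzero_roots (char_poly A) + nonzero_roots (char_poly B)"
  using arg_cong[OF char_poly_add_orthogonal[OF assms], of nonzero_roots] A B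
    char_poly_nonzero[of A n] char_poly_nonzero[of B n] char_poly_nonzero[of "A + B" n]
  by (auto simp: nonzero_roots_power_x nonzero_roots_mult)

text \<open>
  If \<open>A A\<^sup>T v = k v\<close> then \<open>k\<close> times the square norm of \<open>v\<close> is the square norm of \<open>A\<^sup>T v\<close>. The
  argument is carried out for complex \<open>v\<close>, because that is where eigenvalues are known to exist.
\<close>

lemma complex_eigenvalue_gram:
  fixes A :: "real mat"
  assumes A: "A \<in> carrier_mat n m"
    and k: "poly (char_poly (map_mat of_real (A * A\<^sup>T))) k = (0::complex)"
  shows "k \<in> \<real> \<and> 0 \<le> Re k"
proof -
  let ?A = "map_mat of_real A :: complex mat"
  have cA: "?A \<in> carrier_mat n m" using A by simp
  have G: "map_mat of_real (A * A\<^sup>T) = ?A * ?A\<^sup>T"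
    using A by (subst of_real_hom.mat_hom_mult[of _ n m]) (auto simp: map_mat_transpose)
  have "eigenvalue (?A * ?A\<^sup>T) k"
    using k cA by (subst eigenvalue_root_char_poly[of _ n]) (auto simp: G)
  then obtain v where v: "v \<in> carrier_vec n" "v \<noteq> 0\<^sub>v n" "(?A * ?A\<^sup>T) *\<^sub>v v = k \<cdot>\<^sub>v v"
    using cA by (auto simp: eigenvalue_def eigenvector_def)
  define w where "w = ?A\<^sup>T *\<^sub>v v"
  have w: "w \<in> carrier_vec m" using cA v by (auto simp: w_def)
  have cw: "conjugate w = ?A\<^sup>T *\<^sub>v conjugate v"
    using cA v by (intro eq_vecI) (auto simp: w_def scalar_prod_def)
  have "k * (v \<bullet>c v) = (k \<cdot>\<^sub>v v) \<bullet>c v"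
    using v by (subst smult_scalar_prod_distrib[of _ n]) auto
  also have "\<dots> = (?A *\<^sub>v w) \<bullet> conjugate v"
    using v(3) assoc_mult_mat_vec[OF cA _ v(1), of "?A\<^sup>T"] cA by (simp add: w_def)
  also have "\<dots> = w \<bullet> (?A\<^sup>T *\<^sub>v conjugate v)"
    using transpose_vec_mult_scalar[of "?A\<^sup>T" m n "conjugate v" w] cA v w by simp
  finally have eq: "k * (v \<bullet>c v) = w \<bullet>c w" by (simp add: cw)
  have pos: "0 < v \<bullet>c v" using v by simp
  have "0 \<le> w \<bullet>c w" by auto
  with eq pos have "Im k = 0" "0 \<le> Re k * Re (v \<bullet>c v)" "0 < Re (v \<bullet>c v)"
    by (auto simp: less_complex_def less_eq_complex_def complex_eq_iff)
  then show ?thesis by (auto simp: complex_is_Real_iff zero_le_mult_iff)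
qed

lemma proots_prod_linear: "proots (\<Prod>a\<leftarrow>as. [:- a, 1:]) = mset (as :: 'a :: idom list)"
proof (induction as)
  case (Cons a as)
  have "(\<Prod>a\<leftarrow>as. [:- a, 1:]) \<noteq> 0"
    by (subst prod_list_zero_iff) auto
  with Cons show ?case by (simp add: proots_mult del: mult_pCons_left)
qed simp

text \<open>
  The characteristic polynomial factors over the complex numbers, and all its roots are
  nonnegative reals. Counting the roots matters later, as the zero eigenvalues are counted as
  well.
\<close>

lemma char_poly_gram_splits:
  fixes A :: "real mat"
  assumes A: "A \<in> carrier_mat n m"
  shows "size (proots (char_poly (A * A\<^sup>T))) = n" and "\<forall>x \<in># proots (char_poly (A * A\<^sup>T)). 0 \<le> x"
proof -
  let ?p = "char_poly (A * A\<^sup>T)"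
  interpret p: map_poly_inj_idom_hom "of_real :: real \<Rightarrow> complex" ..
  have G: "A * A\<^sup>T \<in> carrier_mat n n" using A by auto
  then have G': "map_mat of_real (A * A\<^sup>T) \<in> carrier_mat n n" by simp
  obtain as where as: "char_poly (map_mat of_real (A * A\<^sup>T)) = (\<Prod>a\<leftarrow>as. [:- a, 1:] :: complex poly)"
    and len: "length as = n"
    using char_poly_factorized[OF G'] by auto
  have real: "a \<in> \<real> \<and> 0 \<le> Re a" if "a \<in> set as" for a
  proof (rule complex_eigenvalue_gram[OF A])
    show "poly (char_poly (map_mat of_real (A * A\<^sup>T))) a = 0"
      using that unfolding as by (induction as) auto
  qed
  let ?q = "\<Prod>a\<leftarrow>map Re as. [:- a, 1:]"
  have "map_poly of_real ?p = (\<Prod>a\<leftarrow>as. [:- a, 1:] :: complex poly)"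
    using of_real_hom.char_poly_hom[OF G, where ?'a = complex] as by metis
  also have "\<dots> = map_poly of_real ?q"
    using real
    by (induction as)
      (simp_all add: p.hom_mult complex_is_Real_iff complex_eq_iff del: mult_pCons_left)
  finally have p: "?p = ?q"
    by (simp only: p.eq_iff)
  have "proots ?q = mset (map Re as)"
    by (rule proots_prod_linear)
  then show "size (proots ?p) = n" "\<forall>x \<in># proots ?p. 0 \<le> x"
    using len real by (auto simp: p)
qed

text \<open>
  Substituting \<open>x - c\<close> for \<open>x\<close> is an automorphism of the polynomial ring, so it carries the powers
  of \<open>x - a\<close> that divide \<open>p\<close> to the powers of \<open>x - (a + c)\<close> that divide the image of \<open>p\<close>.
\<close>

lemma order_pcompose_shift:
  fixes p :: "'a :: idom poly"
  assumes "p \<noteq> 0"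
  shows "order (c + a) (pcompose p [:- c, 1:]) = order a p"
proof -
  have shift: "[:- x, 1:] ^ n dvd q \<longleftrightarrow> [:- (x + c), 1:] ^ n dvd pcompose q [:- c, 1:]"
    for x c :: 'a and n q
  proof -
    have pow: "pcompose ([:- x, 1:] ^ n) [:- c, 1:] = [:- (x + c), 1:] ^ n" for x c :: 'a
      by (induction n) (simp_all add: pcompose_mult pcompose_pCons del: mult_pCons_left)
    have dvd: "[:- (x + c), 1:] ^ n dvd pcompose q [:- c, 1:]" if "[:- x, 1:] ^ n dvd q"
      for x c :: 'a and q
      using that by (auto simp: dvd_def pcompose_mult pow)
    have inv: "pcompose (pcompose q [:- c, 1:]) [:- (- c), 1:] = q"
      by (simp add: pcompose_pCons flip: pcompose_assoc)
    show ?thesis using dvd[of x q c] dvd[of "x + c" "pcompose q [:- c, 1:]" "- c"]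
      by (auto simp: inv[simplified])
  qed
  have nz: "pcompose p [:- c, 1:] \<noteq> 0"
    using assms by (simp add: pcompose_eq_0_iff)
  show ?thesis
  proof (rule antisym)
    let ?n = "order (c + a) (pcompose p [:- c, 1:])"
    show "?n \<le> order a p"
      using order_1[of "c + a" "pcompose p [:- c, 1:]"] shift[where x = a and n = ?n and q = p and c = c]
        order_divides[of a ?n p] assms by (simp add: add.commute)
    show "order a p \<le> ?n"
      using order_1[of a p] shift[where x = a and n = "order a p" and q = p and c = c]
        order_divides[of "c + a" "order a p" "pcompose p [:- c, 1:]"] nz by (simp add: add.commute)
  qed
qed

lemma proots_char_poly_shift:
  fixes S :: "real mat"
  assumes S: "S \<in> carrier_mat n n"
  shows "proots (char_poly (c \<cdot>\<^sub>m 1\<^sub>m n + S)) = image_mset ((+) c) (proots (char_poly S))"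
proof (rule multiset_eqI)
  fix x
  have eq: "char_poly (c \<cdot>\<^sub>m 1\<^sub>m n + S) = pcompose (char_poly S) [:- c, 1:]"
    unfolding poly_eq_poly_eq_iff[symmetric]
    by (intro ext) (simp add: poly_char_poly_shift[OF S] poly_pcompose)
  have count: "count (image_mset ((+) c) M) x = count M (x - c)" for M
    by (induction M) auto
  show "count (proots (char_poly (c \<cdot>\<^sub>m 1\<^sub>m n + S))) x
      = count (image_mset ((+) c) (proots (char_poly S))) x"
    using order_pcompose_shift[OF char_poly_nonzero[OF S], of c "x - c"]
      char_poly_nonzero[OF S]
    by (simp add: eq count pcompose_eq_0_iff)
qed

text \<open>
  The product of the two summands contains the factor \<open>V\<^sup>T H = 0\<close>, so their nonzero spectra are
  simply joined. Moving \<open>V\<close> and \<open>H\<close> to the other end of the products turns the summands into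
  \<open>(P/2) V\<^sup>T V = P\<close> and \<open>(P/2 + 1) H\<^sup>T H = 2 + P + Q\<close>, the latter by \<open>P Q = 0\<close>.
\<close>

lemma nonzero_roots_orthogonal_sandwich:
  fixes P :: "real mat"
  assumes V: "V \<in> carrier_mat N l" and H: "H \<in> carrier_mat N l"
    and P: "P \<in> carrier_mat l l" and Q: "Q \<in> carrier_mat l l"
    and VV: "V\<^sup>T * V = 2 \<cdot>\<^sub>m 1\<^sub>m l" and VH: "V\<^sup>T * H = 0\<^sub>m l l"
    and HH: "H\<^sup>T * H = 2 \<cdot>\<^sub>m 1\<^sub>m l + Q" and PQ: "P * Q = 0\<^sub>m l l"
    and L: "L = V * ((1/2) \<cdot>\<^sub>m P * V\<^sup>T) + H * (((1/2) \<cdot>\<^sub>m P + 1\<^sub>m l) * H\<^sup>T)"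
  shows "nonzero_roots (char_poly L)
    = nonzero_roots (char_poly P) + nonzero_roots (char_poly (2 \<cdot>\<^sub>m 1\<^sub>m l + (P + Q)))"
proof -
  define A B where "A = (1/2) \<cdot>\<^sub>m P * V\<^sup>T" and "B = ((1/2) \<cdot>\<^sub>m P + 1\<^sub>m l) * H\<^sup>T"
  have A: "A \<in> carrier_mat l N" and B: "B \<in> carrier_mat l N"
    using V H P by (auto simp: A_def B_def)
  have "V * A * (H * B) = V * ((1/2) \<cdot>\<^sub>m P * (V\<^sup>T * H * B))"
  proof -
    have "V * A * (H * B) = V * (A * (H * B))"
      by (rule assoc_mult_mat[of _ N l _ N _ N]) (use V H A B in auto)
    also have "A * (H * B) = (1/2) \<cdot>\<^sub>m P * (V\<^sup>T * (H * B))"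
      unfolding A_def by (rule assoc_mult_mat[of _ l l _ N _ N]) (use V H P B in auto)
    also have "V\<^sup>T * (H * B) = V\<^sup>T * H * B"
      by (rule assoc_mult_mat[of _ l N _ l _ N, symmetric]) (use V H B in auto)
    finally show ?thesis .
  qed
  also have "\<dots> = 0\<^sub>m N N"
    using V P left_mult_zero_mat[OF B, of l] right_mult_zero_mat[OF V, of N]
      right_mult_zero_mat[of "(1/2) \<cdot>\<^sub>m P" l l N] by (simp add: VH)
  finally have "nonzero_roots (char_poly L)
      = nonzero_roots (char_poly (V * A)) + nonzero_roots (char_poly (H * B))"
    unfolding L A_def[symmetric] B_def[symmetric]
    by (intro nonzero_roots_add_orthogonal[of _ N]) (use V H A B in auto)
  also have "nonzero_roots (char_poly (V * A)) = nonzero_roots (char_poly (A * V))"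
    by (rule nonzero_roots_mult_commute[OF V A])
  also have "A * V = (1/2) \<cdot>\<^sub>m P * (V\<^sup>T * V)"
    unfolding A_def by (rule assoc_mult_mat[of _ l l _ N _ l]) (use V P in auto)
  also have "\<dots> = P"
    using P unfolding VV
    by (subst mult_smult_distrib[of _ l l _ l]) (auto intro!: eq_matI)
  also have "nonzero_roots (char_poly (H * B)) = nonzero_roots (char_poly (B * H))"
    by (rule nonzero_roots_mult_commute[OF H B])
  also have "B * H = ((1/2) \<cdot>\<^sub>m P + 1\<^sub>m l) * (H\<^sup>T * H)"
    unfolding B_def by (rule assoc_mult_mat[of _ l l _ N _ l]) (use H P in auto)
  also have "\<dots> = ((1/2) \<cdot>\<^sub>m P + 1\<^sub>m l) * (2 \<cdot>\<^sub>m 1\<^sub>m l) + ((1/2) \<cdot>\<^sub>m P + 1\<^sub>m l) * Q"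
    unfolding HH by (rule mult_add_distrib_mat[of _ l l _ l]) (use P Q in auto)
  also have "((1/2) \<cdot>\<^sub>m P + 1\<^sub>m l) * (2 \<cdot>\<^sub>m 1\<^sub>m l) = 2 \<cdot>\<^sub>m 1\<^sub>m l + P"
    using P by (subst mult_smult_distrib[of _ l l _ l]) (auto intro!: eq_matI)
  also have "((1/2) \<cdot>\<^sub>m P + 1\<^sub>m l) * Q = Q"
    using P Q by (subst add_mult_distrib_mat[of _ l l _ _ l])
      (auto simp: mult_smult_assoc_mat[of _ l l _ l] PQ)
  also have "2 \<cdot>\<^sub>m 1\<^sub>m l + P + Q = 2 \<cdot>\<^sub>m 1\<^sub>m l + (P + Q)"
    by (rule assoc_add_mat[of _ l l]) (use P Q in auto)
  finally show ?thesis .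
qed

lemma filter_zero_mset:
  fixes M :: "'a :: zero multiset"
  shows "M = {#x \<in># M. x \<noteq> 0#} + replicate_mset (size M - size {#x \<in># M. x \<noteq> 0#}) 0"
proof -
  have zeros: "{#x \<in># M. \<not> x \<noteq> 0#} = replicate_mset (count M 0) 0"
    by (rule multiset_eqI) auto
  have M: "M = {#x \<in># M. x \<noteq> 0#} + replicate_mset (count M 0) 0"
    unfolding zeros[symmetric] by (rule multiset_partition)
  have "size M - size {#x \<in># M. x \<noteq> 0#} = count M 0"
    using arg_cong[OF M, of size] by simp
  with M show ?thesis by simp
qed

text \<open>
  The linear algebra behind the theorem: \<open>P = A A\<^sup>T\<close> and \<open>Q = C\<^sup>T C\<close> are put into
  \<open>nonzero_roots_orthogonal_sandwich\<close>.
  As \<open>P Q = A (C A)\<^sup>T C = 0\<close>, the roots for \<open>P + Q\<close> are the multiset \<open>S\<close> padded with zeros to \<open>l\<close>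
  elements; adding \<open>2\<close> to \<open>P + Q\<close> adds \<open>2\<close> to each of these, zeros included. They are all
  nonnegative, so none of the sums vanishes.
\<close>

lemma nonzero_roots_two_orthogonal_images:
  fixes A :: "real mat"
  assumes V: "V \<in> carrier_mat N l" and H: "H \<in> carrier_mat N l"
    and A: "A \<in> carrier_mat l q" and C: "C \<in> carrier_mat m l"
    and VV: "V\<^sup>T * V = 2 \<cdot>\<^sub>m 1\<^sub>m l" and VH: "V\<^sup>T * H = 0\<^sub>m l l"
    and HH: "H\<^sup>T * H = 2 \<cdot>\<^sub>m 1\<^sub>m l + C\<^sup>T * C" and CA: "C * A = 0\<^sub>m m q"
    and L: "L = (1/2) \<cdot>\<^sub>m (V * A * (V * A)\<^sup>T) + ((1/2) \<cdot>\<^sub>m (H * A * (H * A)\<^sup>T) + H * H\<^sup>T)"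
  defines "S \<equiv> nonzero_roots (char_poly (A * A\<^sup>T)) + nonzero_roots (char_poly (C * C\<^sup>T))"
  shows "nonzero_roots (char_poly L) = nonzero_roots (char_poly (A * A\<^sup>T))
      + image_mset ((+) 2) (S + replicate_mset (l - size S) 0)"
    and "size S \<le> l" and "\<forall>x \<in># S. 0 \<le> x"
proof -
  let ?P = "A * A\<^sup>T" and ?Q = "C\<^sup>T * C"
  have P: "?P \<in> carrier_mat l l" and Q: "?Q \<in> carrier_mat l l" using A C by auto
  have PQ: "?P * ?Q = 0\<^sub>m l l"
  proof -
    have "?P * ?Q = A * (A\<^sup>T * ?Q)"
      by (rule assoc_mult_mat[of _ l q _ l _ l]) (use A C in auto)
    also have "A\<^sup>T * ?Q = A\<^sup>T * C\<^sup>T * C"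
      by (rule assoc_mult_mat[of _ q l _ m _ l, symmetric]) (use A C in auto)
    also have "A\<^sup>T * C\<^sup>T = 0\<^sub>m q m"
      unfolding transpose_mult[OF C A, symmetric] CA by auto
    finally show ?thesis
      using A C by (simp add: left_mult_zero_mat[OF C] right_mult_zero_mat[OF A])
  qed
  have half: "W * ((1/2) \<cdot>\<^sub>m ?P * W\<^sup>T) = (1/2) \<cdot>\<^sub>m (W * A * (W * A)\<^sup>T)"
    if W: "W \<in> carrier_mat N l" for W
  proof -
    have "W * A * (W * A)\<^sup>T = W * (A * (W * A)\<^sup>T)"
      by (rule assoc_mult_mat[of _ N l _ q _ N]) (use W A in auto)
    also have "A * (W * A)\<^sup>T = ?P * W\<^sup>T"
      unfolding transpose_mult[OF W A]
      by (rule assoc_mult_mat[of _ l q _ l _ N, symmetric]) (use W A in auto)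
    finally show ?thesis
      using W P by (simp add: mult_smult_assoc_mat[of _ l l _ N] mult_smult_distrib[of _ N l _ N])
  qed
  have L': "L = V * ((1/2) \<cdot>\<^sub>m ?P * V\<^sup>T) + H * (((1/2) \<cdot>\<^sub>m ?P + 1\<^sub>m l) * H\<^sup>T)"
  proof -
    have "((1/2) \<cdot>\<^sub>m ?P + 1\<^sub>m l) * H\<^sup>T = (1/2) \<cdot>\<^sub>m ?P * H\<^sup>T + H\<^sup>T"
      using H P by (subst add_mult_distrib_mat[of _ l l _ _ N]) auto
    then have "H * (((1/2) \<cdot>\<^sub>m ?P + 1\<^sub>m l) * H\<^sup>T) = H * ((1/2) \<cdot>\<^sub>m ?P * H\<^sup>T) + H * H\<^sup>T"
      using H P mult_carrier_mat[of "(1/2) \<cdot>\<^sub>m ?P" l l "H\<^sup>T" N]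
      by (simp only:) (rule mult_add_distrib_mat[of _ N l _ N], auto)
    then show ?thesis by (simp only: L half[OF V] half[OF H])
  qed
  define R where "R = proots (char_poly (?P + ?Q))"
  have splitQ: "size (proots (char_poly ?Q)) = l" "\<forall>x \<in># proots (char_poly ?Q). 0 \<le> x"
    using char_poly_gram_splits[of "C\<^sup>T" l m] C by auto
  note splitP = char_poly_gram_splits[OF A]
  have nz: "char_poly ?P \<noteq> 0" "char_poly ?Q \<noteq> 0" "char_poly (?P + ?Q) \<noteq> 0"
    using char_poly_nonzero[OF P] char_poly_nonzero[OF Q] char_poly_nonzero[of "?P + ?Q" l] P Q
    by auto
  have "proots ([:0, 1:] ^ l * char_poly (?P + ?Q)) = proots (char_poly ?P) + proots (char_poly ?Q)"
    unfolding char_poly_add_orthogonal[OF P Q PQ] using nz by (simp add: proots_mult)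
  then have R: "proots ([:0, 1:] ^ l) + R = proots (char_poly ?P) + proots (char_poly ?Q)"
    using nz by (simp add: R_def proots_mult)
  have "size (proots ([:0, 1:] ^ l :: real poly)) = l"
    by (simp add: proots_power)
  with arg_cong[OF R, of size] splitP(1) splitQ(1) have sizeR: "size R = l"
    by simp
  have nonneg: "\<forall>x \<in># R. 0 \<le> x"
    using arg_cong[OF R, of set_mset] splitP(2) splitQ(2) by auto
  have "nonzero_roots (char_poly ?Q) = nonzero_roots (char_poly (C * C\<^sup>T))"
    using nonzero_roots_mult_commute[of C m l "C\<^sup>T"] C by simp
  then have S: "S = {#x \<in># R. x \<noteq> 0#}"
    using nonzero_roots_add_orthogonal[OF P Q PQ]
    by (simp add: S_def R_def nonzero_roots_def)
  show "size S \<le> l" "\<forall>x \<in># S. 0 \<le> x"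
    using size_filter_mset_lesseq[of "\<lambda>x. x \<noteq> 0" R] sizeR nonneg by (auto simp: S)
  have RS: "S + replicate_mset (l - size S) 0 = R"
    using filter_zero_mset[of R] by (simp add: S sizeR)
  have "nonzero_roots (char_poly (2 \<cdot>\<^sub>m 1\<^sub>m l + (?P + ?Q))) = {#x \<in># image_mset ((+) 2) R. x \<noteq> 0#}"
    using P Q by (simp add: nonzero_roots_def R_def proots_char_poly_shift[of "?P + ?Q" l])
  also have "\<dots> = image_mset ((+) 2) R"
    using nonneg by (auto simp: filter_mset_eq_conv)
  finally show "nonzero_roots (char_poly L) = nonzero_roots (char_poly ?P)
      + image_mset ((+) 2) (S + replicate_mset (l - size S) 0)"
    unfolding RS using nonzero_roots_orthogonal_sandwich[OF V H P Q VV VH HH PQ L'] by simp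
qed

section \<open>Weakly decreasing sequences\<close>

text \<open>
  Adding \<open>2\<close> to the first \<open>l\<close> entries preserves the order because the entries beyond the end of
  \<open>a\<close> count as \<open>0\<close> and \<open>a\<close> is nonnegative. This is how the eigenvalue \<open>0\<close>, absent from \<open>a\<close>,
  reappears as the eigenvalue \<open>2\<close>.
\<close>

lemma replicate_seq_add:
  assumes "sorted (rev a)" and "\<forall>x \<in> set a. 0 \<le> x" and len: "length a \<le> l"
  shows "replicate l 2 \<oplus> a = rev (sorted_list_of_multiset
    (image_mset ((+) 2) (mset a + replicate_mset (l - length a) 0)))"
proof -
  define b where "b = map ((+) 2) (a @ replicate (l - length a) 0)"
  have "replicate l 2 \<oplus> a = b"
    using len by (intro nth_equalityI) (auto simp: seq_add_def b_def nth_default_def nth_append)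
  moreover have "sorted (rev b)"
    using assms(1,2) by (auto simp: b_def rev_map sorted_append sorted_map intro: sorted_wrt_mono_rel)
  then have "sorted_list_of_multiset (mset (rev b)) = rev b"
    by (simp only: sorted_list_of_multiset_mset sorted_sort_id)
  moreover have "mset (rev b) = image_mset ((+) 2) (mset a + replicate_mset (l - length a) 0)"
    by (simp add: b_def)
  ultimately show ?thesis by (metis rev_rev_ident)
qed

lemma seq_union_rev_sorted_list:
  "a \<uplus> b = rev (sorted_list_of_multiset (mset a + mset b))"
  by (simp add: seq_union_def flip: mset_append)

lemma spectrum_seq_nonzero_roots:
  "spectrum_seq Y = rev (sorted_list_of_multiset
     (nonzero_roots (char_poly (laplacian_ud Y (complex_dim Y - 1)))))"
  by (simp add: spectrum_seq_def nonzero_roots_def)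

section \<open>Faces, incidence numbers and the boundary of a boundary\<close>

lemma face_of_refl: "face_of f f"
  by (simp add: face_of_def)

lemma finite_dirs: "finite (dom f) \<Longrightarrow> finite (dirs f)"
  by (rule finite_subset[of _ "dom f"]) (auto simp: dirs_def)

lemma dirs_upd: "dirs (f(i \<mapsto> e)) = (if e = Star then insert i (dirs f) else dirs f - {i})"
  by (auto simp: dirs_def)

lemma dirs_mono: "face_of f g \<Longrightarrow> dirs f \<subseteq> dirs g"
  by (force simp: face_of_def dirs_def)

lemma face_of_eq_if_dirs:
  assumes "face_of f g" and "dirs g \<subseteq> dirs f" shows "f = g"
proof
  fix i show "f i = g i"
  proof (cases "g i = Some Star")
    case True
    with assms(2) have "f i = Some Star" by (auto simp: dirs_def)
    with True show ?thesis by simp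
  qed (use assms(1) in \<open>auto simp: face_of_def\<close>)
qed

text \<open>
  Faces of codimension 1 are described from below, by the entry that becomes free. All later
  computations with incidence numbers go through this description.
\<close>

lemma codim_1_face_iff:
  assumes fin: "finite (dom f)"
  shows "face_of f g \<and> face_dim g = face_dim f + 1
    \<longleftrightarrow> (\<exists>c e. f c = Some e \<and> e \<noteq> Star \<and> g = f(c \<mapsto> Star))"
proof
  assume l: "face_of f g \<and> face_dim g = face_dim f + 1"
  then have dom: "dom f = dom g" and fg: "face_of f g" by (auto simp: face_of_def)
  have sub: "dirs f \<subseteq> dirs g" using dirs_mono[OF fg] .
  have "card (dirs g - dirs f) = 1"
    using l card_Diff_subset[OF finite_dirs[OF fin] sub] by (simp add: face_dim_def)
  then obtain c where c: "dirs g - dirs f = {c}" by (auto simp: card_1_singleton_iff)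
  then have "c \<in> dom f" using dom by (auto simp: dirs_def)
  then obtain e where e: "f c = Some e" by auto
  with c have eS: "e \<noteq> Star" by (auto simp: dirs_def)
  have "g = f(c \<mapsto> Star)"
  proof
    fix j show "g j = (f(c \<mapsto> Star)) j"
    proof (cases "g j = Some Star")
      case True
      then have "j = c \<or> j \<in> dirs f" using c by (auto simp: dirs_def)
      then show ?thesis using True by (auto simp: dirs_def)
    next
      case False
      then have "f j = g j" "j \<noteq> c" using fg c by (auto simp: face_of_def dirs_def)
      then show ?thesis by simp
    qed
  qed
  with e eS show "\<exists>c e. f c = Some e \<and> e \<noteq> Star \<and> g = f(c \<mapsto> Star)" by blast
next
  assume "\<exists>c e. f c = Some e \<and> e \<noteq> Star \<and> g = f(c \<mapsto> Star)"
  then obtain c e where c: "f c = Some e" "e \<noteq> Star" "g = f(c \<mapsto> Star)" by auto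
  have "c \<notin> dirs f" using c by (simp add: dirs_def)
  with c show "face_of f g \<and> face_dim g = face_dim f + 1"
    using finite_dirs[OF fin] by (auto simp: face_of_def face_dim_def dirs_upd)
qed

lemma incidence_upd_Star:
  assumes fin: "finite (dom f)" and e: "f c = Some e" "e \<noteq> Star"
  shows "incidence f (f(c \<mapsto> Star))
    = (if e = E0 then - 1 else 1) * (- 1) ^ card {b \<in> dirs f. b < c}"
proof -
  have c: "c \<notin> dirs f" using e by (simp add: dirs_def)
  have diff: "dirs (f(c \<mapsto> Star)) - dirs f = {c}" using c by (auto simp: dirs_upd)
  have "{b \<in> dirs (f(c \<mapsto> Star)). b \<le> c} = insert c {b \<in> dirs f. b < c}"
    using c by (auto simp: dirs_upd le_less)
  then have "card {b \<in> dirs (f(c \<mapsto> Star)). b \<le> c} = Suc (card {b \<in> dirs f. b < c})"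
    using finite_dirs[OF fin] by simp
  moreover have "face_of f (f(c \<mapsto> Star)) \<and> face_dim (f(c \<mapsto> Star)) = face_dim f + 1"
    using codim_1_face_iff[OF fin] e by blast
  ultimately show ?thesis
    using e by (simp add: incidence_def diff Let_def)
qed

lemma incidence_nonzeroE:
  assumes "incidence f g \<noteq> 0" and "finite (dom f)"
  obtains c e where "f c = Some e" "e \<noteq> Star" "g = f(c \<mapsto> Star)"
  using assms codim_1_face_iff[of f g] by (auto simp: incidence_def split: if_splits)

text \<open>
  The boundary of a boundary vanishes. If \<open>w\<close> has codimension 2 in \<open>y\<close>, with directions \<open>a < b\<close>
  missing, the only faces between them free one of \<open>a\<close> and \<open>b\<close>. Their terms cancel: freeing \<open>a\<close>
  first moves \<open>b\<close> one position up, whereas freeing \<open>b\<close> first does not move \<open>a\<close>.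
\<close>

lemma incidence_incidence_sum:
  assumes fin: "finite A" and dom: "finite (dom w)"
    and closed: "\<And>z. face_of z y \<Longrightarrow> face_dim z + 1 = face_dim y \<Longrightarrow> z \<in> A"
  shows "(\<Sum>z\<in>A. incidence w z * incidence z y) = 0"
proof (cases "\<exists>z. incidence w z * incidence z y \<noteq> 0")
  case True
  then obtain z where "incidence w z \<noteq> 0" and zy: "incidence z y \<noteq> 0" by auto
  then obtain c e where c: "w c = Some e" "e \<noteq> Star" and z: "z = w(c \<mapsto> Star)"
    using dom by (auto elim: incidence_nonzeroE)
  obtain c' e' where c': "z c' = Some e'" "e' \<noteq> Star" and y: "y = z(c' \<mapsto> Star)"
    using zy dom by (auto simp: z elim: incidence_nonzeroE)
  have ne: "c' \<noteq> c" using c' by (auto simp: z)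
  define a where "a = min c c'"
  define b where "b = max c c'"
  have ab: "a < b" using ne by (auto simp: a_def b_def)
  have y': "y = w(a \<mapsto> Star, b \<mapsto> Star)" "y = w(b \<mapsto> Star, a \<mapsto> Star)"
    using ne by (auto simp: y z a_def b_def min_def max_def fun_upd_twist)
  obtain p q where p: "w a = Some p" "p \<noteq> Star" and q: "w b = Some q" "q \<noteq> Star"
    using c c' ne by (cases "c < c'") (auto simp: z a_def b_def min_def max_def split: if_splits)
  let ?A = "w(a \<mapsto> Star)" and ?B = "w(b \<mapsto> Star)"
  have fin': "finite (dom ?A)" "finite (dom ?B)" using dom by auto
  have neAB: "?A \<noteq> ?B"
    using ab p by (metis fun_upd_other fun_upd_same less_irrefl option.inject)
  have "?A \<in> A"
    using codim_1_face_iff[OF fin'(1), of y] closed[of ?A] y'(1) q ab by force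
  moreover have "?B \<in> A"
    using codim_1_face_iff[OF fin'(2), of y] closed[of ?B] y'(2) p ab by force
  moreover have "incidence w x * incidence x y = 0" if "x \<notin> {?A, ?B}" for x
  proof (rule ccontr)
    assume "incidence w x * incidence x y \<noteq> 0"
    then have 1: "incidence w x \<noteq> 0" and 2: "incidence x y \<noteq> 0" by auto
    from 1 dom obtain r er where r: "w r = Some er" "er \<noteq> Star" "x = w(r \<mapsto> Star)"
      by (auto elim: incidence_nonzeroE)
    from 2 dom r(3) obtain s where s: "y = x(s \<mapsto> Star)"
      by (auto elim: incidence_nonzeroE)
    have "r \<in> dirs y" "r \<notin> dirs w" using r s by (auto simp: dirs_upd dirs_def)
    then have "r = a \<or> r = b" by (auto simp: y' dirs_upd)
    with r that show False by auto
  qed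
  ultimately have "(\<Sum>z\<in>A. incidence w z * incidence z y)
      = (\<Sum>z\<in>{?A, ?B}. incidence w z * incidence z y)"
    using fin by (intro sum.mono_neutral_right) auto
  also have "\<dots> = incidence w ?A * incidence ?A y + incidence w ?B * incidence ?B y"
    using neAB by simp
  also have "\<dots> = 0"
  proof -
    have "a \<notin> dirs w" using p by (simp add: dirs_def)
    have "{x \<in> dirs ?A. x < b} = insert a {x \<in> dirs w. x < b}"
      "{x \<in> dirs ?B. x < a} = {x \<in> dirs w. x < a}"
      using ab by (auto simp: dirs_upd)
    then have "card {x \<in> dirs ?A. x < b} = Suc (card {x \<in> dirs w. x < b})"
      "card {x \<in> dirs ?B. x < a} = card {x \<in> dirs w. x < a}"
      using \<open>a \<notin> dirs w\<close> finite_dirs[OF dom] by auto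
    moreover have "?A b = Some q" "?B a = Some p" using p q ab by auto
    ultimately show ?thesis
      using incidence_upd_Star[OF dom p] incidence_upd_Star[OF dom q]
        incidence_upd_Star[OF fin'(1), of b q] incidence_upd_Star[OF fin'(2), of a p] p q
      unfolding y'(1)[symmetric] y'(2)[symmetric] by simp
  qed
  finally show ?thesis .
qed (auto intro: sum.neutral)

lemma face_of_upd_upd:
  assumes "f i = None" and "g i = None"
  shows "face_of (f(i \<mapsto> e)) (g(i \<mapsto> e')) \<longleftrightarrow> face_of f g \<and> (e' = Star \<or> e = e')"
proof -
  have "dom (f(i \<mapsto> e)) = dom (g(i \<mapsto> e')) \<longleftrightarrow> dom f = dom g"
    using assms by (simp add: insert_ident domIff)
  moreover have "((g(i \<mapsto> e')) j \<noteq> Some Star \<longrightarrow> (f(i \<mapsto> e)) j = (g(i \<mapsto> e')) j)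
      \<longleftrightarrow> (if j = i then e' = Star \<or> e = e' else g j \<noteq> Some Star \<longrightarrow> f j = g j)" for j
    by auto
  moreover have "(\<forall>j. if j = i then e' = Star \<or> e = e' else g j \<noteq> Some Star \<longrightarrow> f j = g j)
      \<longleftrightarrow> (\<forall>j. g j \<noteq> Some Star \<longrightarrow> f j = g j) \<and> (e' = Star \<or> e = e')"
    using assms by metis
  ultimately show ?thesis unfolding face_of_def by simp
qed

lemma upd_eq_upd_iff:
  assumes "f i = None" and "g i = None"
  shows "f(i \<mapsto> e) = g(i \<mapsto> e') \<longleftrightarrow> f = g \<and> e = e'"
proof
  assume eq: "f(i \<mapsto> e) = g(i \<mapsto> e')"
  have "f j = g j" for j
    using fun_cong[OF eq, of j] assms by (cases "j = i") auto
  moreover have "e = e'" using fun_cong[OF eq, of i] by simp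
  ultimately show "f = g \<and> e = e'" by auto
qed auto

lemma face_dim_upd:
  assumes "f i = None" and "finite (dom f)"
  shows "face_dim (f(i \<mapsto> e)) = face_dim f + (if e = Star then 1 else 0)"
proof -
  have "i \<notin> dirs f" using assms by (simp add: dirs_def)
  then show ?thesis using finite_dirs[OF assms(2)] by (simp add: face_dim_def dirs_upd)
qed

text \<open>
  The new direction \<open>i\<close> precedes all others. Freeing it therefore shifts every other direction by
  one position, which flips the sign of the incidence numbers, while \<open>i\<close> itself is always in the
  first position.
\<close>

lemma incidence_upd_upd:
  assumes f: "f i = None" "finite (dom f)" and g: "g i = None" "finite (dom g)"
    and less: "\<And>a. a \<in> dom f \<Longrightarrow> i < a"
  shows "incidence (f(i \<mapsto> e)) (g(i \<mapsto> e')) =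
    (if e = e' then (if e = Star then - incidence f g else incidence f g)
     else if e' = Star \<and> f = g then (if e = E0 then - 1 else 1) else 0)"
proof -
  have fin: "finite (dom (f(i \<mapsto> e)))" using f by simp
  consider "e = e'" | "e \<noteq> e'" "e' = Star" "f = g" | "e \<noteq> e'" "\<not> (e' = Star \<and> f = g)"
    by blast
  then show ?thesis
  proof cases
    case 1
    have codim: "face_of (f(i \<mapsto> e)) (g(i \<mapsto> e)) \<and> face_dim (g(i \<mapsto> e)) = face_dim (f(i \<mapsto> e)) + 1
        \<longleftrightarrow> face_of f g \<and> face_dim g = face_dim f + 1"
      using f g by (simp add: face_of_upd_upd face_dim_upd)
    show ?thesis
    proof (cases "face_of f g \<and> face_dim g = face_dim f + 1")
      case True
      then obtain c p where c: "f c = Some p" "p \<noteq> Star" "g = f(c \<mapsto> Star)"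
        using codim_1_face_iff[OF f(2)] by blast
      define F where "F = f(i \<mapsto> e)"
      have ic: "i < c" using less c by auto
      then have gF: "g(i \<mapsto> e) = F(c \<mapsto> Star)" and Fc: "F c = Some p"
        using c by (auto simp: F_def fun_upd_twist)
      have i: "i \<notin> dirs f" using f by (simp add: dirs_def)
      have "{b \<in> dirs F. b < c}
          = (if e = Star then insert i {b \<in> dirs f. b < c} else {b \<in> dirs f. b < c})"
        using ic i by (auto simp: F_def dirs_upd)
      then have "card {b \<in> dirs F. b < c} = card {b \<in> dirs f. b < c} + (if e = Star then 1 else 0)"
        using i finite_dirs[OF f(2)] by simp
      moreover have "finite (dom F)" using fin by (simp add: F_def)
      ultimately have "incidence F (g(i \<mapsto> e)) = (if e = Star then - incidence f g else incidence f g)"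
        using incidence_upd_Star[of F c p] incidence_upd_Star[OF f(2) c(1,2)] c(2,3) Fc gF by simp
      then show ?thesis using 1 by (simp add: F_def)
    next
      case False
      with codim 1 show ?thesis by (auto simp: incidence_def)
    qed
  next
    case 2
    have "{b \<in> dirs (f(i \<mapsto> e)). b < i} = {}"
      using less by (force simp: dirs_def split: if_splits)
    then have card0: "card {b \<in> dirs (f(i \<mapsto> e)). b < i} = 0" by (simp only: card.empty)
    have "g(i \<mapsto> e') = f(i \<mapsto> e, i \<mapsto> Star)" using 2 by simp
    then show ?thesis
      using incidence_upd_Star[OF fin, of i e, unfolded card0] 2 by simp
  next
    case 3
    have "\<not> (face_of (f(i \<mapsto> e)) (g(i \<mapsto> e')) \<and> face_dim (g(i \<mapsto> e')) = face_dim (f(i \<mapsto> e)) + 1)"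
    proof
      assume *: "face_of (f(i \<mapsto> e)) (g(i \<mapsto> e')) \<and> face_dim (g(i \<mapsto> e')) = face_dim (f(i \<mapsto> e)) + 1"
      then have e: "e' = Star" and fg: "face_of f g" and "face_dim f = face_dim g"
        using f g 3 by (auto simp: face_of_upd_upd face_dim_upd)
      then have "dirs f = dirs g"
        using dirs_mono[OF fg] finite_dirs[OF g(2)] by (simp add: face_dim_def card_subset_eq)
      then have "f = g" using face_of_eq_if_dirs[OF fg] by simp
      with e 3 show False by simp
    qed
    with 3 show ?thesis by (auto simp: incidence_def)
  qed
qed

section \<open>Near-prisms\<close>

text \<open>
  The prism direction \<open>i\<close> is required to be the smallest one, which makes the incidence signs
  uniform.
\<close>

locale near_prism_complex =
  fixes i :: nat and D :: "nat set" and X :: "face set"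
  assumes complex: "cubical_complex (insert i D) X"
    and first: "\<And>a. a \<in> D \<Longrightarrow> i < a"
    and near: "near_prism i X"
begin

abbreviation Y where "Y \<equiv> del i X"
abbreviation Z where "Z \<equiv> link i X"

lemma i_notin: "i \<notin> D" using first by blast

lemma finite_D: "finite D" and X_closed: "g \<in> X \<Longrightarrow> face_of f g \<Longrightarrow> f \<in> X"
  and dom_X: "f \<in> X \<Longrightarrow> dom f = insert i D" and X_nonempty: "X \<noteq> {}"
  using complex by (auto simp: cubical_complex_def)

lemma remove_entry_upd: "f i = None \<Longrightarrow> remove_entry i (f(i \<mapsto> e)) = f"
  by (auto simp: remove_entry_def restrict_map_def)

lemma remove_entry_None: "remove_entry i f i = None"
  by (simp add: remove_entry_def)

lemma upd_remove_entry: "f i = Some e \<Longrightarrow> (remove_entry i f)(i \<mapsto> e) = f"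
  by (auto simp: remove_entry_def restrict_map_def)

lemma X_cases:
  assumes "f \<in> X" obtains y e where "y i = None" "f = y(i \<mapsto> e)"
proof -
  have "i \<in> dom f" using dom_X[OF assms] by simp
  then obtain e where "f i = Some e" by auto
  with that[of "remove_entry i f" e] show ?thesis
    by (simp add: remove_entry_None upd_remove_entry)
qed

lemma link_iff: "z \<in> Z \<longleftrightarrow> z i = None \<and> z(i \<mapsto> Star) \<in> X"
proof
  assume "z \<in> Z"
  then obtain f where f: "f \<in> X" "f i = Some Star" "z = remove_entry i f" by (auto simp: link_def)
  then show "z i = None \<and> z(i \<mapsto> Star) \<in> X" by (simp add: remove_entry_None upd_remove_entry)
next
  assume "z i = None \<and> z(i \<mapsto> Star) \<in> X"
  then show "z \<in> Z" unfolding link_def using remove_entry_upd[of z Star] by force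
qed

lemma del_iff:
  assumes "e \<noteq> Star" shows "y \<in> Y \<longleftrightarrow> y i = None \<and> y(i \<mapsto> e) \<in> X"
proof
  assume y: "y \<in> Y"
  then have None: "y i = None" by (auto simp: del_def remove_entry_None)
  then have "y(i \<mapsto> e) \<in> prism i Y" using y by (simp add: prism_def remove_entry_upd)
  then have "y(i \<mapsto> e) \<in> X"
    using near assms by (cases e) (auto simp: near_prism_def zero_copy_def one_copy_def)
  with None show "y i = None \<and> y(i \<mapsto> e) \<in> X" by simp
next
  assume "y i = None \<and> y(i \<mapsto> e) \<in> X"
  then show "y \<in> Y" unfolding del_def using assms remove_entry_upd[of y e] by force
qed

lemma del_None: "y \<in> Y \<Longrightarrow> y i = None" and link_None: "z \<in> Z \<Longrightarrow> z i = None"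
  using del_iff[of E0] link_iff by auto

lemma dom_del: assumes "y \<in> Y" shows "dom y = D"
proof -
  have "y(i \<mapsto> E0) \<in> X" "i \<notin> dom y"
    using del_iff[of E0 y] assms by auto
  then have "insert i (dom y) = insert i D" using dom_X[of "y(i \<mapsto> E0)"] by simp
  then show ?thesis using i_notin \<open>i \<notin> dom y\<close> by (simp add: insert_ident)
qed

lemma link_subset_del: "Z \<subseteq> Y"
proof
  fix z assume "z \<in> Z"
  then have z: "z i = None" "z(i \<mapsto> Star) \<in> X" by (auto simp: link_iff)
  have "face_of (z(i \<mapsto> E0)) (z(i \<mapsto> Star))"
    using z by (simp add: face_of_upd_upd face_of_refl)
  with z show "z \<in> Y" using X_closed by (simp add: del_iff[of E0])
qed

lemma face_of_None: "face_of f g \<Longrightarrow> g i = None \<Longrightarrow> f i = None"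
  unfolding face_of_def by (metis domIff)

lemma del_closed: assumes "y \<in> Y" "face_of x y" shows "x \<in> Y"
proof -
  have "x i = None" "y i = None" using assms del_None face_of_None by auto
  moreover from this have "face_of (x(i \<mapsto> E0)) (y(i \<mapsto> E0))"
    using assms by (simp add: face_of_upd_upd)
  ultimately show ?thesis using assms X_closed by (auto simp: del_iff[of E0])
qed

lemma link_closed: assumes "y \<in> Z" "face_of x y" shows "x \<in> Z"
proof -
  have "x i = None" "y i = None" using assms link_None face_of_None by auto
  moreover from this have "face_of (x(i \<mapsto> Star)) (y(i \<mapsto> Star))"
    using assms by (simp add: face_of_upd_upd)
  ultimately show ?thesis using assms X_closed by (auto simp: link_iff)
qed

lemma finite_X: "finite X"
proof -
  have "finite (UNIV :: entry set)"
  proof -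
    have "(UNIV :: entry set) \<subseteq> {E0, E1, Star}" using entry.exhaust by auto
    then show ?thesis by (rule finite_subset) simp
  qed
  then have "finite {f :: face. dom f = insert i D \<and> ran f \<subseteq> UNIV}"
    using finite_D by (intro finite_set_of_finite_maps) auto
  then show ?thesis by (rule finite_subset[rotated]) (auto dest: dom_X)
qed

lemma finite_Y: "finite Y" and finite_Z: "finite Z"
proof -
  have "Y \<subseteq> remove_entry i ` X" by (auto simp: del_def)
  then show "finite Y" using finite_X by (auto intro: finite_subset)
  then show "finite Z" using link_subset_del by (rule finite_subset[rotated])
qed

lemma finite_dom_del: "y \<in> Y \<Longrightarrow> finite (dom y)"
  using dom_del finite_D by simp

lemma face_dim_del:
  assumes "y \<in> Y" shows "face_dim (y(i \<mapsto> e)) = face_dim y + (if e = Star then 1 else 0)"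
  using assms del_None finite_dom_del by (simp add: face_dim_upd)

lemma incidence_del:
  assumes "f \<in> Y" and "g \<in> Y"
  shows "incidence (f(i \<mapsto> e)) (g(i \<mapsto> e')) =
    (if e = e' then (if e = Star then - incidence f g else incidence f g)
     else if e' = Star \<and> f = g then (if e = E0 then - 1 else 1) else 0)"
  using assms del_None finite_dom_del dom_del first by (intro incidence_upd_upd) auto

lemma faces_X:
  "faces X k = (\<lambda>y. y(i \<mapsto> E0)) ` faces Y k \<union> (\<lambda>y. y(i \<mapsto> E1)) ` faces Y k
    \<union> (\<lambda>z. z(i \<mapsto> Star)) ` faces Z (k - 1)" (is "_ = ?R")
proof
  show "faces X k \<subseteq> ?R"
  proof
    fix f assume f: "f \<in> faces X k"
    then have fX: "f \<in> X" by (simp add: faces_def)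
    then obtain y e where None: "y i = None" and e: "f = y(i \<mapsto> e)" by (rule X_cases)
    have inX: "y(i \<mapsto> e) \<in> X" using e fX by simp
    have dim: "int (face_dim (y(i \<mapsto> e))) = k" using e f by (simp add: faces_def)
    show "f \<in> ?R"
    proof (cases "e = Star")
      case True
      then have "y \<in> Z" using None inX by (simp add: link_iff)
      moreover from this have "int (face_dim y) = k - 1"
        using dim True link_subset_del face_dim_del[of y e] by auto
      ultimately show ?thesis using e True by (auto simp: faces_def)
    next
      case False
      then have "y \<in> Y" using None inX by (simp add: del_iff[of e])
      moreover from this have "int (face_dim y) = k"
        using dim False face_dim_del[of y e] by auto
      moreover have "e = E0 \<or> e = E1" using False by (cases e) auto
      ultimately show ?thesis using e by (auto simp: faces_def)
    qed
  qed
  show "?R \<subseteq> faces X k"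
  proof
    fix f assume "f \<in> ?R"
    then obtain y e where f: "f = y(i \<mapsto> e)" and
      y: "if e = Star then y \<in> faces Z (k - 1) else y \<in> faces Y k"
      by fastforce
    then have yY: "y \<in> Y" using link_subset_del by (auto simp: faces_def split: if_splits)
    have "f \<in> X" using y f by (auto simp: faces_def del_iff[of e] link_iff split: if_splits)
    moreover have "int (face_dim f) = k"
      using y by (auto simp: f faces_def face_dim_del[OF yY] split: if_splits)
    ultimately show "f \<in> faces X k" by (simp add: faces_def)
  qed
qed

lemma finite_faces: "finite (faces X k)" "finite (faces Y k)" "finite (faces Z k)"
  using finite_X finite_Y finite_Z by (auto simp: faces_def)

text \<open>
  The form in which the decomposition of \<open>X\<close> into two copies of the deletion and the extended link
  enters matrix products.
\<close>

lemma sum_faces_X: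
  "(\<Sum>f\<in>faces X k. F f) = (\<Sum>y\<in>faces Y k. F (y(i \<mapsto> E0)) + F (y(i \<mapsto> E1)))
    + (\<Sum>z\<in>faces Z (k - 1). F (z(i \<mapsto> Star)))" for F :: "face \<Rightarrow> real"
proof -
  have None: "y i = None" if "y \<in> faces Y k \<union> faces Z (k - 1)" for y
    using that del_None link_None by (auto simp: faces_def)
  have inj: "inj_on (\<lambda>y. y(i \<mapsto> e)) (faces Y k)" "inj_on (\<lambda>y. y(i \<mapsto> e)) (faces Z (k - 1))" for e
    using None by (auto simp: inj_on_def upd_eq_upd_iff)
  have "(\<Sum>f\<in>faces X k. F f) = (\<Sum>f\<in>(\<lambda>y. y(i \<mapsto> E0)) ` faces Y k. F f)
      + (\<Sum>f\<in>(\<lambda>y. y(i \<mapsto> E1)) ` faces Y k. F f)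
      + (\<Sum>f\<in>(\<lambda>z. z(i \<mapsto> Star)) ` faces Z (k - 1). F f)"
    unfolding faces_X using finite_faces None
    by (subst sum.union_disjoint; (subst sum.union_disjoint)?) (auto simp: upd_eq_upd_iff)
  then show ?thesis by (simp add: sum.reindex inj sum.distrib)
qed

end

lemma face_eq_if_dim_le:
  assumes fg: "face_of f g" and fin: "finite (dom g)" and le: "face_dim g \<le> face_dim f"
  shows "g = f"
proof -
  have "dirs f = dirs g"
    using card_seteq[OF finite_dirs[OF fin] dirs_mono[OF fg]] le by (simp add: face_dim_def)
  then show ?thesis using face_of_eq_if_dirs[OF fg] by simp
qed

lemma complex_dim_facet:
  assumes "finite W" and "W \<noteq> {}" and "\<And>f. f \<in> W \<Longrightarrow> finite (dom f)"
  obtains f where "f \<in> facets W" and "complex_dim W = int (face_dim f)"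
proof -
  have "Max (face_dim ` W) \<in> face_dim ` W" using assms by (intro Max_in) auto
  then obtain f where f: "f \<in> W" "face_dim f = Max (face_dim ` W)" by force
  have "g = f" if "g \<in> W" "face_of f g" for g
    using that assms f by (intro face_eq_if_dim_le) auto
  then have "f \<in> facets W" using f by (simp add: facets_def)
  moreover have "complex_dim W = int (face_dim f)" using f assms by (simp add: complex_dim_def)
  ultimately show ?thesis using that by blast
qed

locale pure_near_prism = near_prism_complex +
  fixes d :: nat
  assumes pure: "pure X" and dim_X: "complex_dim X = int d"
begin

lemma finite_dom_X: "f \<in> X \<Longrightarrow> finite (dom f)"
  using dom_X finite_D by simp

lemma face_dim_facet: assumes "f \<in> facets X" shows "face_dim f = d"
proof -
  obtain g where "g \<in> facets X" "complex_dim X = int (face_dim g)"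
    using complex_dim_facet[OF finite_X X_nonempty finite_dom_X] by blast
  moreover from this have "face_dim f = face_dim g" using pure assms unfolding pure_def by blast
  ultimately show ?thesis using dim_X by simp
qed

lemma face_dim_le: assumes "f \<in> X" shows "face_dim f \<le> d"
proof -
  have "face_dim f \<le> Max (face_dim ` X)" using finite_X assms by simp
  then show ?thesis using dim_X X_nonempty by (simp add: complex_dim_def)
qed

lemma face_dim_del_le: assumes "y \<in> Y" shows "face_dim y \<le> d"
proof -
  have "y(i \<mapsto> E0) \<in> X" using assms del_iff[of E0 y] by simp
  from face_dim_le[OF this] show ?thesis by (simp add: face_dim_del[OF assms])
qed

lemma face_dim_link_le: assumes "z \<in> Z" shows "face_dim z + 1 \<le> d"
proof -
  have "z \<in> Y" "z(i \<mapsto> Star) \<in> X" using assms link_subset_del by (auto simp: link_iff)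
  then show ?thesis using face_dim_le[of "z(i \<mapsto> Star)"] by (simp add: face_dim_del)
qed

text \<open>
  Extending a facet of the link in direction \<open>i\<close> gives a facet of \<open>X\<close>: every face of \<open>X\<close> that
  contains the extension is free in direction \<open>i\<close> and so comes from the link.
\<close>

lemma face_dim_link_facet: assumes "z \<in> facets Z" shows "face_dim z + 1 = d"
proof -
  have z: "z \<in> Z" using assms by (simp add: facets_def)
  have "g = z(i \<mapsto> Star)" if g: "g \<in> X" "face_of (z(i \<mapsto> Star)) g" for g
  proof -
    obtain x e where x: "x i = None" and e: "g = x(i \<mapsto> e)" using g(1) by (rule X_cases)
    have *: "face_of z x" "e = Star"
      using g(2) face_of_upd_upd[of z i x Star e] link_None[OF z] x by (auto simp: e)
    then have "x \<in> Z" using x e g(1) by (simp add: link_iff)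
    with * assms have "x = z" by (simp add: facets_def)
    with e * show ?thesis by simp
  qed
  moreover have "z(i \<mapsto> Star) \<in> X" using z by (simp add: link_iff)
  ultimately have "z(i \<mapsto> Star) \<in> facets X" by (simp add: facets_def)
  then show ?thesis using face_dim_facet[of "z(i \<mapsto> Star)"] face_dim_del[of z Star] z link_subset_del by auto
qed

lemma facets_link: "facets Z = faces Z (int d - 1)"
proof
  show "facets Z \<subseteq> faces Z (int d - 1)"
    using face_dim_link_facet by (force simp: faces_def facets_def)
  show "faces Z (int d - 1) \<subseteq> facets Z"
  proof
    fix z assume "z \<in> faces Z (int d - 1)"
    then have z: "z \<in> Z" "int (face_dim z) = int d - 1" by (auto simp: faces_def)
    have "g = z" if "g \<in> Z" "face_of z g" for g
      using that face_dim_link_le[of g] z finite_dom_del link_subset_del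
      by (intro face_eq_if_dim_le) auto
    with z show "z \<in> facets Z" by (simp add: facets_def)
  qed
qed

text \<open>
  If no face is free in direction \<open>i\<close>, a facet of \<open>X\<close> of positive dimension is a copy of a face of
  the deletion with nonempty boundary, and that boundary would lie in the link.
\<close>

lemma dim_0_if_link_empty: assumes "Z = {}" shows "d = 0"
proof (rule ccontr)
  assume "d \<noteq> 0"
  obtain f where f: "f \<in> facets X"
    using complex_dim_facet[OF finite_X X_nonempty finite_dom_X] by blast
  then have fX: "f \<in> X" by (simp add: facets_def)
  then obtain y e where None: "y i = None" and e: "f = y(i \<mapsto> e)" by (rule X_cases)
  have "e \<noteq> Star" using assms None e fX link_iff[of y] by auto
  then have y: "y \<in> Y" using None e fX by (simp add: del_iff[of e])
  then have "face_dim y \<noteq> 0"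
    using face_dim_del[of y e] \<open>e \<noteq> Star\<close> e face_dim_facet[OF f] \<open>d \<noteq> 0\<close> by simp
  then have "dirs y \<noteq> {}" by (auto simp: face_dim_def)
  then obtain c where c: "y c = Some Star" by (auto simp: dirs_def)
  then have "y(c \<mapsto> E0) \<noteq> y" by (auto simp: fun_upd_idem_iff)
  moreover have "face_of (y(c \<mapsto> E0)) y" using c by (auto simp: face_of_def)
  ultimately have "y(c \<mapsto> E0) \<in> boundary y" by (simp add: boundary_def)
  then show False using near y assms unfolding near_prism_def by blast
qed

text \<open>
  An empty link has dimension \<open>-1\<close>, in agreement with \<open>d = 0\<close> in that case.
\<close>

lemma dim_link: "complex_dim Z = int d - 1"
proof (cases "Z = {}")
  case True
  then show ?thesis using dim_0_if_link_empty by (simp add: complex_dim_def)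
next
  case False
  obtain f where "f \<in> facets Z" "complex_dim Z = int (face_dim f)"
    using complex_dim_facet[OF finite_Z False] finite_dom_del link_subset_del by blast
  then show ?thesis using face_dim_link_facet[of f] by simp
qed

text \<open>
  A copy of \<open>y\<close> is a facet of \<open>X\<close>: a larger face would either be free in direction \<open>i\<close>, which puts
  \<open>y\<close> into the link since links are closed, or come from a larger face of the deletion, whose
  boundary lies in the link.
\<close>

lemma face_dim_del_link: assumes "y \<in> Y" and "y \<notin> Z" shows "face_dim y = d"
proof -
  have None: "y i = None" and yX: "y(i \<mapsto> E0) \<in> X" using assms by (auto simp: del_iff[of E0])
  have "g = y(i \<mapsto> E0)" if g: "g \<in> X" "face_of (y(i \<mapsto> E0)) g" for g
  proof -
    obtain x e where x: "x i = None" and e: "g = x(i \<mapsto> e)" using g(1) by (rule X_cases)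
    have yx: "face_of y x" and e': "e = Star \<or> e = E0"
      using g(2) face_of_upd_upd[of y i x E0 e] None x by (auto simp: e)
    have "e \<noteq> Star" using assms(2) link_closed[OF _ yx] e g(1) x by (auto simp: link_iff)
    then have "x \<in> Y" using e g(1) x by (simp add: del_iff[of e])
    then have "x = y" using near yx assms(2) unfolding near_prism_def boundary_def by blast
    with e e' \<open>e \<noteq> Star\<close> show ?thesis by simp
  qed
  then have "y(i \<mapsto> E0) \<in> facets X" using yX by (simp add: facets_def)
  then show ?thesis using face_dim_facet face_dim_del[OF assms(1), of E0] by simp
qed

lemma faces_del_link: "k < int d \<Longrightarrow> faces Y k = faces Z k"
  using face_dim_del_link link_subset_del by (force simp: faces_def)

text \<open>
  Both conditions say that deletion and link coincide. This turns the case distinction of the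
  theorem into whether the Laplacian of the deletion in degree \<open>d - 1\<close> is the zero matrix.
\<close>

lemma prism_iff: "is_prism (insert i D) i X \<longleftrightarrow> faces Y (int d) = {}"
proof
  assume "is_prism (insert i D) i X"
  then obtain W where W: "X = prism i W" unfolding is_prism_def by (elim exE conjE) (rule that)
  have "Y \<subseteq> Z"
  proof
    fix y assume "y \<in> Y"
    then have y: "y i = None" "y(i \<mapsto> E0) \<in> X" by (auto simp: del_iff[of E0])
    then have "y \<in> W" unfolding W by (simp add: prism_def remove_entry_upd)
    then have "y(i \<mapsto> Star) \<in> X" unfolding W using y by (simp add: prism_def remove_entry_upd)
    with y(1) show "y \<in> Z" by (simp add: link_iff)
  qed
  then show "faces Y (int d) = {}" using face_dim_link_le by (force simp: faces_def)
next
  assume "faces Y (int d) = {}"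
  then have YZ: "Y = Z" using link_subset_del face_dim_del_link by (auto simp: faces_def)
  have "X = prism i Y"
  proof (intro equalityI subsetI)
    fix f assume f: "f \<in> X"
    then obtain y e where y: "y i = None" and e: "f = y(i \<mapsto> e)" by (rule X_cases)
    have "y \<in> Y"
    proof (cases "e = Star")
      case True
      then show ?thesis using y e f unfolding YZ by (simp add: link_iff)
    next
      case False
      then show ?thesis using y e f by (simp add: del_iff[of e])
    qed
    with y e show "f \<in> prism i Y" by (simp add: prism_def remove_entry_upd)
  next
    fix f assume "f \<in> prism i Y"
    then obtain e where e: "f i = Some e" and y: "remove_entry i f \<in> Y" by (auto simp: prism_def)
    then have "(remove_entry i f)(i \<mapsto> e) \<in> X"
      by (cases "e = Star") (use y YZ in \<open>auto simp: link_iff del_iff[of e]\<close>)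
    then show "f \<in> X" using upd_remove_entry[of f e] e by simp
  qed
  moreover have "cubical_complex D Y"
  proof -
    obtain f where f: "f \<in> X" using X_nonempty by blast
    then have "Y \<noteq> {}" using \<open>X = prism i Y\<close> by (auto simp: prism_def)
    then show ?thesis
      using complex finite_D dom_del del_closed by (auto simp: cubical_complex_def)
  qed
  ultimately show "is_prism (insert i D) i X"
    using i_notin unfolding is_prism_def by (metis Diff_insert_absorb)
qed

lemma dim_del: assumes "faces Y (int d) \<noteq> {}" shows "complex_dim Y = int d"
proof -
  obtain y where y: "y \<in> Y" "face_dim y = d" using assms by (auto simp: faces_def)
  have "Max (face_dim ` Y) = d"
    using y finite_Y face_dim_del_le by (intro Max_eqI) auto
  with y show ?thesis by (auto simp: complex_dim_def)
qed

end

section \<open>Matrices indexed by lists\<close>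

text \<open>
  Indexing rows and columns by faces rather than by numbers turns matrix identities into
  identities between sums over sets of faces.
\<close>

definition kernel_mat :: "'a list \<Rightarrow> 'b list \<Rightarrow> ('a \<Rightarrow> 'b \<Rightarrow> real) \<Rightarrow> real mat" where
  "kernel_mat xs ys F = mat (length xs) (length ys) (\<lambda>(r, c). F (xs ! r) (ys ! c))"

lemma kernel_mat_carrier: "kernel_mat xs ys F \<in> carrier_mat (length xs) (length ys)"
  by (simp add: kernel_mat_def)

lemma kernel_mat_transpose: "(kernel_mat xs ys F)\<^sup>T = kernel_mat ys xs (\<lambda>y x. F x y)"
  by (intro eq_matI) (auto simp: kernel_mat_def)

lemma kernel_mat_cong:
  assumes "\<And>x y. x \<in> set xs \<Longrightarrow> y \<in> set ys \<Longrightarrow> F x y = G x y"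
  shows "kernel_mat xs ys F = kernel_mat xs ys G"
  using assms by (intro eq_matI) (auto simp: kernel_mat_def)

lemma kernel_mat_mult:
  assumes "distinct ys"
  shows "kernel_mat xs ys F * kernel_mat ys zs G
    = kernel_mat xs zs (\<lambda>x z. \<Sum>y\<in>set ys. F x y * G y z)"
proof (intro eq_matI)
  fix a b assume ab: "a < dim_row (kernel_mat xs zs (\<lambda>x z. \<Sum>y\<in>set ys. F x y * G y z))"
    "b < dim_col (kernel_mat xs zs (\<lambda>x z. \<Sum>y\<in>set ys. F x y * G y z))"
  have "(\<Sum>k = 0..<length ys. F (xs ! a) (ys ! k) * G (ys ! k) (zs ! b))
      = (\<Sum>y\<in>set ys. F (xs ! a) y * G y (zs ! b))"
    using assms by (intro sum.reindex_bij_betw bij_betw_nth) (auto simp: atLeast0LessThan)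
  with ab show "(kernel_mat xs ys F * kernel_mat ys zs G) $$ (a, b)
      = kernel_mat xs zs (\<lambda>x z. \<Sum>y\<in>set ys. F x y * G y z) $$ (a, b)"
    by (simp add: kernel_mat_def scalar_prod_def)
qed (auto simp: kernel_mat_def)

lemma kernel_mat_add: "kernel_mat xs ys F + kernel_mat xs ys G = kernel_mat xs ys (\<lambda>x y. F x y + G x y)"
  by (intro eq_matI) (auto simp: kernel_mat_def)

lemma kernel_mat_smult: "c \<cdot>\<^sub>m kernel_mat xs ys F = kernel_mat xs ys (\<lambda>x y. c * F x y)"
  by (intro eq_matI) (auto simp: kernel_mat_def)

lemma kernel_mat_one:
  "distinct xs \<Longrightarrow> 1\<^sub>m (length xs) = kernel_mat xs xs (\<lambda>x y. of_bool (x = y))"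
  by (intro eq_matI) (auto simp: kernel_mat_def nth_eq_iff_index_eq)

lemma kernel_mat_zero: "0\<^sub>m (length xs) (length ys) = kernel_mat xs ys (\<lambda>x y. 0)"
  by (intro eq_matI) (auto simp: kernel_mat_def)

lemma boundary_mat_kernel:
  "boundary_mat X k = kernel_mat (face_list X (k - 1)) (face_list X k) incidence"
  by (simp add: boundary_mat_def kernel_mat_def)

lemma face_list:
  assumes "finite (faces X k)"
  shows "distinct (face_list X k)" and "set (face_list X k) = faces X k"
proof -
  have "\<exists>fs. distinct fs \<and> set fs = faces X k"
    using finite_distinct_list[OF assms] by auto
  then have "distinct (face_list X k) \<and> set (face_list X k) = faces X k"
    unfolding face_list_def by (rule someI_ex)
  then show "distinct (face_list X k)" "set (face_list X k) = faces X k" by auto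
qed

section \<open>The Laplacian of a near-prism\<close>

context pure_near_prism
begin

text \<open>
  Here the Laplacian is decomposed by means of \<open>V\<close> and \<open>H\<close>. For the deletion the degree is \<open>d - 1\<close>
  even if \<open>X\<close> is a prism, when the deletion has dimension \<open>d - 1\<close> only; this allows both cases of
  the theorem to be read off from one formula.
\<close>

lemma nonzero_roots_laplacian:
  defines "nz \<equiv> \<lambda>W k. nonzero_roots (char_poly (laplacian_ud W k))"
    and "l \<equiv> card (facets Z)"
  defines "S \<equiv> nz Y (int d - 1) + nz Z (int d - 2)"
  shows "nz X (int d - 1) = nz Y (int d - 1) + image_mset ((+) 2) (S + replicate_mset (l - size S) 0)"
    and "size S \<le> l" and "\<forall>x \<in># S. 0 \<le> x"
proof -
  define k where "k = int d"
  define rs where "rs = face_list X (k - 1)"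
  define ys where "ys = face_list Y k"
  define zs where "zs = face_list Z (k - 1)"
  define ws where "ws = face_list Z (k - 2)"
  note fl = face_list[OF finite_faces(1)] face_list[OF finite_faces(2)] face_list[OF finite_faces(3)]
  have dist: "distinct rs" "distinct ys" "distinct zs" "distinct ws"
    by (simp_all add: rs_def ys_def zs_def ws_def fl)
  have YZ: "faces Y (k - 1) = faces Z (k - 1)" by (simp add: k_def faces_del_link)
  \<comment> \<open>The chosen enumeration of a set of faces depends on this set only, so the matrices of the
    deletion and of the link are indexed in the same order.\<close>
  then have zs: "zs = face_list Y (k - 1)" by (simp add: zs_def face_list_def)
  have sets: "set rs = faces X (k - 1)" "set ys = faces Y k" "set zs = faces Z (k - 1)"
    "set ws = faces Z (k - 2)"
    by (simp_all add: rs_def ys_def zs_def ws_def fl)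
  have ysY: "y \<in> Y" if "y \<in> set ys" for y using that by (simp add: sets faces_def)
  have zsY: "z \<in> Y" if "z \<in> set zs" for z
    using that link_subset_del by (auto simp: sets faces_def)
  have wsY: "w \<in> Y" if "w \<in> set ws" for w
    using that link_subset_del by (auto simp: sets faces_def)
  have len: "length zs = l"
    using distinct_card[OF dist(3)] by (simp add: sets l_def facets_link k_def)
  have rs_cases: thesis
    if "r \<in> set rs" and "\<And>z. z \<in> set zs \<Longrightarrow> r = z(i \<mapsto> E0) \<Longrightarrow> thesis"
      "\<And>z. z \<in> set zs \<Longrightarrow> r = z(i \<mapsto> E1) \<Longrightarrow> thesis"
      "\<And>w. w \<in> set ws \<Longrightarrow> r = w(i \<mapsto> Star) \<Longrightarrow> thesis" for r thesis
    using that unfolding sets faces_X YZ by auto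
  have sum_rs: "(\<Sum>r\<in>set rs. F r) = (\<Sum>z\<in>set zs. F (z(i \<mapsto> E0)) + F (z(i \<mapsto> E1)))
      + (\<Sum>w\<in>set ws. F (w(i \<mapsto> Star)))" for F :: "face \<Rightarrow> real"
    unfolding sets sum_faces_X YZ by simp
  have eq_iff: "f(i \<mapsto> e) = g(i \<mapsto> e') \<longleftrightarrow> f = g \<and> e = e'" if "f \<in> Y" "g \<in> Y" for f g e e'
    using that del_None by (simp add: upd_eq_upd_iff)
  note inc = incidence_del

  define v :: "face \<Rightarrow> face \<Rightarrow> real"
    where "v r z = of_bool (r = z(i \<mapsto> E0) \<or> r = z(i \<mapsto> E1))" for r z
  define h where "h r z = incidence r (z(i \<mapsto> Star))" for r z
  define V where "V = kernel_mat rs zs v"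
  define H where "H = kernel_mat rs zs h"
  define A where "A = boundary_mat Y k"
  define C where "C = boundary_mat Z (k - 1)"
  have A: "A = kernel_mat zs ys incidence"
    by (simp add: A_def boundary_mat_kernel zs ys_def)
  have C: "C = kernel_mat ws zs incidence"
    by (simp add: C_def boundary_mat_kernel zs_def ws_def)
  have v: "v (y(i \<mapsto> e)) z = of_bool (e \<noteq> Star \<and> y = z)" if "y \<in> Y" "z \<in> Y" for y z e
    using that by (cases e) (auto simp: v_def eq_iff)
  have h: "h (y(i \<mapsto> e)) z = (if e = Star then - incidence y z
      else if y = z then (if e = E0 then - 1 else 1) else 0)" if "y \<in> Y" "z \<in> Y" for y z e
    using that by (simp add: h_def inc)
  have VV: "V\<^sup>T * V = 2 \<cdot>\<^sub>m 1\<^sub>m l"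
    unfolding V_def kernel_mat_transpose kernel_mat_mult[OF dist(1)] len[symmetric]
      kernel_mat_one[OF dist(3)] kernel_mat_smult
  proof (rule kernel_mat_cong)
    fix x z assume xz: "x \<in> set zs" "z \<in> set zs"
    have "(\<Sum>r\<in>set rs. v r x * v r z) = (\<Sum>y\<in>set zs. if y = x then 2 * of_bool (x = z) else 0)
        + (\<Sum>w\<in>set ws. 0)"
      unfolding sum_rs using xz zsY wsY
      by (intro arg_cong2[of _ _ _ _ "(+)"] sum.cong) (auto simp: v)
    then show "(\<Sum>r\<in>set rs. v r x * v r z) = 2 * of_bool (x = z)"
      using xz by simp
  qed
  have VH: "V\<^sup>T * H = 0\<^sub>m l l"
    unfolding V_def H_def kernel_mat_transpose kernel_mat_mult[OF dist(1)] len[symmetric]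
      kernel_mat_zero
  proof (rule kernel_mat_cong)
    fix x z assume xz: "x \<in> set zs" "z \<in> set zs"
    show "(\<Sum>r\<in>set rs. v r x * h r z) = 0"
      unfolding sum_rs using xz zsY wsY by (auto simp: v h intro!: sum.neutral)
  qed
  have HH: "H\<^sup>T * H = 2 \<cdot>\<^sub>m 1\<^sub>m l + C\<^sup>T * C"
    unfolding H_def C kernel_mat_transpose kernel_mat_mult[OF dist(1)] kernel_mat_mult[OF dist(4)]
      len[symmetric] kernel_mat_one[OF dist(3)] kernel_mat_smult kernel_mat_add
  proof (rule kernel_mat_cong)
    fix x z assume xz: "x \<in> set zs" "z \<in> set zs"
    have "(\<Sum>r\<in>set rs. h r x * h r z) = (\<Sum>y\<in>set zs. if y = x then 2 * of_bool (x = z) else 0)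
        + (\<Sum>w\<in>set ws. incidence w x * incidence w z)"
      unfolding sum_rs using xz zsY wsY
      by (intro arg_cong2[of _ _ _ _ "(+)"] sum.cong) (auto simp: h)
    then show "(\<Sum>r\<in>set rs. h r x * h r z)
        = 2 * of_bool (x = z) + (\<Sum>w\<in>set ws. incidence w x * incidence w z)"
      using xz by simp
  qed
  \<comment> \<open>The deletion is closed under faces, so the sum runs over all faces between \<open>w\<close> and \<open>y\<close>.\<close>
  have boundary2: "(\<Sum>z\<in>set zs. incidence w z * incidence z y) = 0" if "w \<in> set ws" "y \<in> set ys" for w y
  proof (rule incidence_incidence_sum)
    show "finite (dom w)" using that wsY finite_dom_del by blast
    show "z \<in> set zs" if z: "face_of z y" "face_dim z + 1 = face_dim y" for z
    proof -
      have "z \<in> Y" using del_closed ysY z(1) \<open>y \<in> set ys\<close> by blast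
      moreover have "int (face_dim y) = k" using \<open>y \<in> set ys\<close> by (simp add: sets faces_def)
      ultimately have "z \<in> faces Y (k - 1)" using z(2) by (simp add: faces_def)
      then show ?thesis by (simp add: sets YZ)
    qed
  qed simp
  have CA: "C * A = 0\<^sub>m (length ws) (length ys)"
    unfolding A C kernel_mat_mult[OF dist(3)] kernel_mat_zero
    by (rule kernel_mat_cong) (simp add: boundary2)
  \<comment> \<open>The boundary of \<open>y\<close>, copied to both ends, is the sum of the boundaries of the two copies of \<open>y\<close>.\<close>
  have VA: "V * A = kernel_mat rs ys (\<lambda>r y. incidence r (y(i \<mapsto> E0)) + incidence r (y(i \<mapsto> E1)))"
    unfolding V_def A kernel_mat_mult[OF dist(3)]
  proof (rule kernel_mat_cong)
    fix r y assume r: "r \<in> set rs" and y: "y \<in> set ys"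
    have "(\<Sum>z\<in>set zs. v (x(i \<mapsto> e)) z * incidence z y) = (if e \<noteq> Star \<and> x \<in> set zs then incidence x y else 0)"
      if "x \<in> Y" for x e
    proof -
      have "(\<Sum>z\<in>set zs. v (x(i \<mapsto> e)) z * incidence z y)
          = (\<Sum>z\<in>set zs. if z = x then (if e = Star then 0 else incidence x y) else 0)"
        using that zsY by (intro sum.cong) (auto simp: v)
      then show ?thesis by simp
    qed
    with r y show "(\<Sum>z\<in>set zs. v r z * incidence z y) = incidence r (y(i \<mapsto> E0)) + incidence r (y(i \<mapsto> E1))"
      by (elim rs_cases) (simp_all add: zsY wsY ysY inc)
  qed
  \<comment> \<open>That the boundary of the cell over \<open>y\<close> is itself without boundary is checked directly,
    because this cell need not belong to \<open>X\<close>: on the two ends \<open>H\<close> is plus or minus the identity, and on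
    the faces that are free in direction \<open>i\<close> the claim is the vanishing of \<open>C A\<close>.\<close>
  have HA: "H * A = kernel_mat rs ys (\<lambda>r y. incidence r (y(i \<mapsto> E1)) - incidence r (y(i \<mapsto> E0)))"
    unfolding H_def A kernel_mat_mult[OF dist(3)]
  proof (rule kernel_mat_cong)
    fix r y assume r: "r \<in> set rs" and y: "y \<in> set ys"
    have bdry: "(\<Sum>z\<in>set zs. h (x(i \<mapsto> e)) z * incidence z y)
        = (if x \<in> set zs then (if e = E0 then - 1 else 1) * incidence x y else 0)"
      if "x \<in> Y" "e \<noteq> Star" for x e
    proof -
      have "(\<Sum>z\<in>set zs. h (x(i \<mapsto> e)) z * incidence z y)
          = (\<Sum>z\<in>set zs. if z = x then (if e = E0 then - 1 else 1) * incidence x y else 0)"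
        using that zsY by (intro sum.cong) (auto simp: h)
      then show ?thesis by simp
    qed
    have star: "(\<Sum>z\<in>set zs. h (w(i \<mapsto> Star)) z * incidence z y) = 0" if "w \<in> set ws" for w
    proof -
      have "(\<Sum>z\<in>set zs. h (w(i \<mapsto> Star)) z * incidence z y)
          = - (\<Sum>z\<in>set zs. incidence w z * incidence z y)"
        unfolding sum_negf[symmetric] using that zsY wsY by (intro sum.cong) (auto simp: h)
      then show ?thesis using boundary2[OF that y] by simp
    qed
    from r y bdry star show "(\<Sum>z\<in>set zs. h r z * incidence z y)
        = incidence r (y(i \<mapsto> E1)) - incidence r (y(i \<mapsto> E0))"
      by (elim rs_cases) (simp_all add: zsY wsY ysY inc)
  qed
  \<comment> \<open>The two copies of \<open>y\<close> contribute \<open>a a\<^sup>T + b b\<^sup>T = ((a + b) (a + b)\<^sup>T + (b - a) (b - a)\<^sup>T) / 2\<close>,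
    where \<open>a\<close> and \<open>b\<close> are their boundaries; the extended cells contribute \<open>H H\<^sup>T\<close>.\<close>
  have L: "laplacian_ud X (k - 1)
      = (1/2) \<cdot>\<^sub>m (V * A * (V * A)\<^sup>T) + ((1/2) \<cdot>\<^sub>m (H * A * (H * A)\<^sup>T) + H * H\<^sup>T)"
    unfolding VA HA unfolding H_def laplacian_ud_def boundary_mat_kernel kernel_mat_transpose
      kernel_mat_mult[OF dist(2)] kernel_mat_mult[OF dist(3)] kernel_mat_smult kernel_mat_add
  proof -
    have "kernel_mat rs (face_list X k) incidence * kernel_mat (face_list X k) rs (\<lambda>y x. incidence x y)
        = kernel_mat rs rs (\<lambda>r s. \<Sum>f\<in>faces X k. incidence r f * incidence s f)"
      by (subst kernel_mat_mult) (simp_all add: fl)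
    also have "\<dots> = kernel_mat rs rs (\<lambda>r s.
        1/2 * (\<Sum>y\<in>set ys. (incidence r (y(i \<mapsto> E0)) + incidence r (y(i \<mapsto> E1)))
            * (incidence s (y(i \<mapsto> E0)) + incidence s (y(i \<mapsto> E1))))
        + (1/2 * (\<Sum>y\<in>set ys. (incidence r (y(i \<mapsto> E1)) - incidence r (y(i \<mapsto> E0)))
            * (incidence s (y(i \<mapsto> E1)) - incidence s (y(i \<mapsto> E0))))
          + (\<Sum>z\<in>set zs. h r z * h s z)))"
    proof (rule kernel_mat_cong)
      fix r s
      let ?i0 = "\<lambda>r y. incidence r (y(i \<mapsto> E0))" and ?i1 = "\<lambda>r y. incidence r (y(i \<mapsto> E1))"
      have "(\<Sum>y\<in>set ys. ?i0 r y * ?i0 s y + ?i1 r y * ?i1 s y)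
          = 1/2 * (\<Sum>y\<in>set ys. (?i0 r y + ?i1 r y) * (?i0 s y + ?i1 s y))
            + 1/2 * (\<Sum>y\<in>set ys. (?i1 r y - ?i0 r y) * (?i1 s y - ?i0 s y))"
        unfolding sum_distrib_left sum.distrib[symmetric] by (rule sum.cong) (auto simp: field_simps)
      then show "(\<Sum>f\<in>faces X k. incidence r f * incidence s f)
          = 1/2 * (\<Sum>y\<in>set ys. (?i0 r y + ?i1 r y) * (?i0 s y + ?i1 s y))
            + (1/2 * (\<Sum>y\<in>set ys. (?i1 r y - ?i0 r y) * (?i1 s y - ?i0 s y))
            + (\<Sum>z\<in>set zs. h r z * h s z))"
        by (simp add: sum_faces_X sets h_def)
    qed
    finally show "kernel_mat (face_list X (k - 1 + 1 - 1)) (face_list X (k - 1 + 1)) incidence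
        * kernel_mat (face_list X (k - 1 + 1)) (face_list X (k - 1 + 1 - 1)) (\<lambda>y x. incidence x y)
      = kernel_mat rs rs (\<lambda>r s.
        1/2 * (\<Sum>y\<in>set ys. (incidence r (y(i \<mapsto> E0)) + incidence r (y(i \<mapsto> E1)))
            * (incidence s (y(i \<mapsto> E0)) + incidence s (y(i \<mapsto> E1))))
        + (1/2 * (\<Sum>y\<in>set ys. (incidence r (y(i \<mapsto> E1)) - incidence r (y(i \<mapsto> E0)))
            * (incidence s (y(i \<mapsto> E1)) - incidence s (y(i \<mapsto> E0))))
          + (\<Sum>z\<in>set zs. h r z * h s z)))"
      by (simp add: rs_def)
  qed
  have lap: "A * A\<^sup>T = laplacian_ud Y (k - 1)" "C * C\<^sup>T = laplacian_ud Z (k - 2)"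
    by (simp_all add: A_def C_def laplacian_ud_def)
  have carrier: "V \<in> carrier_mat (length rs) l" "H \<in> carrier_mat (length rs) l"
    "A \<in> carrier_mat l (length ys)" "C \<in> carrier_mat (length ws) l"
    using kernel_mat_carrier len by (metis V_def, metis H_def, metis A, metis C)
  note main = nonzero_roots_two_orthogonal_images[OF carrier VV VH HH CA L, unfolded lap]
  from main show "nz X (int d - 1) = nz Y (int d - 1)
      + image_mset ((+) 2) (S + replicate_mset (l - size S) 0)" "size S \<le> l" "\<forall>x \<in># S. 0 \<le> x"
    unfolding nz_def S_def k_def by auto
qed

theorem spectrum_prism:
  assumes "is_prism (insert i D) i X"
  shows "spectrum_seq X = replicate (card (facets Z)) 2 \<oplus> spectrum_seq Z"
proof -
  let ?nz = "\<lambda>W k. nonzero_roots (char_poly (laplacian_ud W k))"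
  have "face_list Y (int d) = []"
    using assms face_list(2)[OF finite_faces(2), of "int d"] by (simp add: prism_iff)
  then have "laplacian_ud Y (int d - 1) = 0\<^sub>m (length (face_list Y (int d - 1))) (length (face_list Y (int d - 1)))"
    by (intro eq_matI) (auto simp: laplacian_ud_def boundary_mat_def scalar_prod_def)
  \<comment> \<open>The zero matrix factors through dimension \<open>0\<close>, where the characteristic polynomial is \<open>1\<close>.\<close>
  then have zero: "?nz Y (int d - 1) = {#}"
    using nonzero_roots_mult_commute[of "0\<^sub>m (length (face_list Y (int d - 1))) 0 :: real mat"
        "length (face_list Y (int d - 1))" 0 "0\<^sub>m 0 (length (face_list Y (int d - 1)))"]
    by (simp add: nonzero_roots_def char_poly_def)
  have sZ: "spectrum_seq Z = rev (sorted_list_of_multiset (?nz Z (int d - 2)))"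
    by (simp add: spectrum_seq_nonzero_roots dim_link)
  have sX: "spectrum_seq X = rev (sorted_list_of_multiset (?nz X (int d - 1)))"
    by (simp add: spectrum_seq_nonzero_roots dim_X)
  note main = nonzero_roots_laplacian[unfolded zero, simplified]
  have "replicate (card (facets Z)) 2 \<oplus> spectrum_seq Z = rev (sorted_list_of_multiset
    (image_mset ((+) 2) (mset (spectrum_seq Z) + replicate_mset (card (facets Z) - length (spectrum_seq Z)) 0)))"
    by (rule replicate_seq_add)
      (use main in \<open>auto simp: sZ simp flip: size_mset\<close>)
  then show ?thesis
    using main by (simp add: sX sZ flip: size_mset)
qed

theorem spectrum_not_prism:
  assumes "\<not> is_prism (insert i D) i X"
  shows "spectrum_seq X = spectrum_seq Y
    \<uplus> (replicate (card (facets Z)) 2 \<oplus> (spectrum_seq Y \<uplus> spectrum_seq Z))"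
proof -
  let ?nz = "\<lambda>W k. nonzero_roots (char_poly (laplacian_ud W k))"
  let ?S = "?nz Y (int d - 1) + ?nz Z (int d - 2)"
  have sZ: "spectrum_seq Z = rev (sorted_list_of_multiset (?nz Z (int d - 2)))"
    by (simp add: spectrum_seq_nonzero_roots dim_link)
  have sX: "spectrum_seq X = rev (sorted_list_of_multiset (?nz X (int d - 1)))"
    by (simp add: spectrum_seq_nonzero_roots dim_X)
  have sY: "spectrum_seq Y = rev (sorted_list_of_multiset (?nz Y (int d - 1)))"
    using assms by (simp add: spectrum_seq_nonzero_roots dim_del prism_iff)
  have union: "spectrum_seq Y \<uplus> spectrum_seq Z = rev (sorted_list_of_multiset ?S)"
    by (simp add: seq_union_rev_sorted_list sY sZ)
  note main = nonzero_roots_laplacian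
  have "replicate (card (facets Z)) 2 \<oplus> (spectrum_seq Y \<uplus> spectrum_seq Z)
    = rev (sorted_list_of_multiset (image_mset ((+) 2)
        (mset (spectrum_seq Y \<uplus> spectrum_seq Z)
          + replicate_mset (card (facets Z) - length (spectrum_seq Y \<uplus> spectrum_seq Z)) 0)))"
    by (rule replicate_seq_add)
      (use main(2,3) in \<open>auto simp: union simp flip: size_mset\<close>)
  then show ?thesis
    using main(1) by (simp add: seq_union_rev_sorted_list sX sY sZ flip: size_mset)
qed

end

theorem theorem5p4:
  fixes n d l :: nat and X :: "face set"
  assumes "1 \<le> n"
    and "cubical_complex {1..n} X"
    and "pure X" and "complex_dim X = int d"
    and "near_prism 1 X"
    and "l = card (facets (link 1 X))"
  shows "(is_prism {1..n} 1 X \<longrightarrow>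
           spectrum_seq X \<doteq> replicate l 2 \<oplus> spectrum_seq (link 1 X)) \<and>
         (\<not> is_prism {1..n} 1 X \<longrightarrow>
           spectrum_seq X \<doteq>
             spectrum_seq (del 1 X) \<uplus>
               (replicate l 2 \<oplus> (spectrum_seq (del 1 X) \<uplus> spectrum_seq (link 1 X))))"
proof -
  have n: "insert 1 {2..n} = {1..n}" using assms(1) by auto
  interpret pure_near_prism 1 "{2..n}" X d
    by unfold_locales (use assms n in auto)
  show ?thesis
    using spectrum_prism spectrum_not_prism unfolding n assms(6) seq_eq_def by metis
qed

end
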